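(* Fix positive integers $r,m$ with $\omega=\frac{r}{m}\le \frac12$, an odd prime $p$ of the form $p=lm+1$ with $l$ a positive integer, and positive integers $k,n$ with $n\ge 2k$. Let $T_s(z,q)\in\mathbb{Z}[z,q]$, $s=0,1,2,\dots$, be the polynomials defined in the context below. Then for every $s\ge 1$, $$ \frac{T_{s+1}(z,q)}{T_{s}(z^p,q^p)} \equiv \frac{T_{s}(z,q)}{T_{s-1}(z^p,q^p)} \pmod{[p^s]_q}, $$ where $[p^s]_q=\frac{1-q^{p^s}}{1-q}=1+q+\dots+q^{p^s-1}$; that is, the difference of the two sides is divisible by the polynomial $[p^s]_q$ (equivalently, $T_{s+1}(z,q)\,T_{s-1}(z^p,q^p)-T_s(z,q)\,T_s(z^p,q^p)$ is divisible by $[p^s]_q$ in $\mathbb{Z}[z,q]$).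
   Context: Setting. Let $\omega=r/m\le 1/2$ ($r,m$ positive integers), $p=lm+1$ an odd prime, and $n\ge 2k$ positive integers. For $1\le i\le n-1$ define $\mathrm{v}_i=i$ if $i<k$, $\mathrm{v}_i=k$ if $k\le i\le n-k$, and $\mathrm{v}_i=n-i$ if $i>n-k$. Introduce variables $x_{i,j}$ for $1\le i\le n-1$, $1\le j\le \mathrm{v}_i$, and a variable $z$ and a parameter $q$. Note that $(p^s-1)\omega$ and $\frac{(p^s-1)(1-2\omega)}{2}$ are nonnegative integers. For $s\ge 0$ define $$ \overline{\Phi}_s(x,z,q)=\Big(\prod_{i=1}^{n-1}\prod_{j=1}^{\mathrm{v}_i}x_{i,j}\Big)^{(p^s-1)(1-\omega)}\prod_{i=1}^{n-1}\prod_{\substack{1\le a\ne b\le \mathrm{v}_i}}\ \prod_{t=0}^{\frac{(p^s-1)(1-2\omega)}{2}-1}(x_{i,a}-q^{t}x_{i,b}) $$ $$ \times\prod_{i=1}^{n-2}\prod_{a=1}^{\mathrm{v}_i}\prod_{b=1}^{\mathrm{v}_{i+1}}\prod_{t=0}^{(p^s-1)\omega-1}(x_{i,a}-q^{t}x_{i+1,b})\times\prod_{a=1}^{k}\prod_{t=0}^{(p^s-1)\omega-1}(z-q^{t}x_{k,a})(1-q^{t}x_{n-k,a}), $$ (empty products equal $1$), let $\Delta(x)=\prod_{i=1}^{n-1}\prod_{1\le a<b\le \mathrm{v}_i}(x_{i,b}-x_{i,a})$, and $\Phi_s(x,z,q)=\Delta(x)\,\overline{\Phi}_s(x,z,q)$.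 Define $$ T_s(z,q)=(-1)^{(p^s-1)N\omega}\,\mathrm{coeff}_{x^{dp^s-1}}\,\Phi_s(x,z,q), $$ the (sign-adjusted) coefficient of the monomial $x^{dp^s-1}:=\prod_{i=1}^{n-1}\prod_{j=1}^{\mathrm{v}_i}x_{i,j}^{\,j p^s-1}$ in $\Phi_s(x,z,q)$, viewed as a polynomial in the $x_{i,j}$ with coefficients in $\mathbb{Z}[z,q]$. Here $N$ is a fixed integer independent of $s$ (it only fixes an overall sign normalization). In particular $T_0(z,q)=1$. *)

theory Defs
  imports
    "HOL-Library.Poly_Mapping"
    "HOL-Computational_Algebra.Primes"
    "HOL-Computational_Algebra.Polynomial"
begin

text \<open>
  Elements of \<open>\<int>[z,q]\<close> are represented in \<^typ>\<open>int poly poly\<close>: the outer polynomial variable is \<open>z\<close>,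
  the variable of the coefficients is \<open>q\<close>.
\<close>

definition zvar :: "int poly poly" where
  "zvar = [:0, 1:]"

definition qvar :: "int poly poly" where
  "qvar = [:[:0, 1:]:]"

definition subst_powers :: "nat \<Rightarrow> int poly poly \<Rightarrow> int poly poly"
  \<comment> \<open>\<open>f(z,q) \<mapsto> f(z\<^sup>p,q\<^sup>p)\<close>\<close> where
  "subst_powers p f = pcompose (map_poly (\<lambda>c. pcompose c (monom 1 p)) f) (monom 1 p)"

definition q_bracket :: "nat \<Rightarrow> int poly poly" where
  "q_bracket M = (\<Sum>i<M. qvar ^ i)"

text \<open>
  Polynomials in the variables \<open>x\<^sub>i\<^sub>,\<^sub>j\<close> over \<open>\<int>[z,q]\<close> are finitely supported maps from monomials to
  coefficients, a monomial being a finitely supported map from index pairs \<open>(i,j)\<close> to exponents.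
\<close>

type_synonym xmonom = "(nat \<times> nat) \<Rightarrow>\<^sub>0 nat"
type_synonym xpoly = "xmonom \<Rightarrow>\<^sub>0 int poly poly"

definition xvar :: "nat \<Rightarrow> nat \<Rightarrow> xpoly" where
  "xvar i j = Poly_Mapping.single (Poly_Mapping.single (i, j) 1) 1"

definition xconst :: "int poly poly \<Rightarrow> xpoly" where
  "xconst c = Poly_Mapping.single 0 c"

definition vdim :: "nat \<Rightarrow> nat \<Rightarrow> nat \<Rightarrow> nat" where
  "vdim k n i = (if i < k then i else if i \<le> n - k then k else n - i)"

text \<open>
  The exponents \<open>(p\<^sup>s-1)\<omega>\<close>, \<open>(p\<^sup>s-1)(1-\<omega>)\<close> and \<open>(p\<^sup>s-1)(1-2\<omega>)/2\<close> for \<open>\<omega> = r/m\<close>. For \<open>2r \<le> m\<close> and an odd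
  \<open>p \<equiv> 1\<close> modulo \<open>m\<close>, no subtraction is truncated and all divisions are exact (if \<open>m\<close> is odd,
  then \<open>2m\<close> divides \<open>p\<^sup>s-1\<close>; if \<open>m\<close> is even, then so is \<open>m-2r\<close>).
\<close>

definition exp_om :: "nat \<Rightarrow> nat \<Rightarrow> nat \<Rightarrow> nat \<Rightarrow> nat" where
  "exp_om r m p s = (p ^ s - 1) * r div m"

definition exp_one_minus_om :: "nat \<Rightarrow> nat \<Rightarrow> nat \<Rightarrow> nat \<Rightarrow> nat" where
  "exp_one_minus_om r m p s = (p ^ s - 1) * (m - r) div m"

definition exp_half_one_minus_two_om :: "nat \<Rightarrow> nat \<Rightarrow> nat \<Rightarrow> nat \<Rightarrow> nat" where
  "exp_half_one_minus_two_om r m p s = (p ^ s - 1) * (m - 2 * r) div (2 * m)"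

definition Phi_bar :: "nat \<Rightarrow> nat \<Rightarrow> nat \<Rightarrow> nat \<Rightarrow> nat \<Rightarrow> nat \<Rightarrow> xpoly" where
  "Phi_bar r m p k n s =
     (\<Prod>i\<in>{1..n-1}. \<Prod>j\<in>{1..vdim k n i}. xvar i j) ^ exp_one_minus_om r m p s
   * (\<Prod>i\<in>{1..n-1}. \<Prod>a\<in>{1..vdim k n i}. \<Prod>b\<in>{1..vdim k n i} - {a}.
        \<Prod>t<exp_half_one_minus_two_om r m p s. xvar i a - xconst (qvar ^ t) * xvar i b)
   * (\<Prod>i\<in>{1..n-2}. \<Prod>a\<in>{1..vdim k n i}. \<Prod>b\<in>{1..vdim k n (i+1)}.
        \<Prod>t<exp_om r m p s. xvar i a - xconst (qvar ^ t) * xvar (i+1) b)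
   * (\<Prod>a\<in>{1..k}. \<Prod>t<exp_om r m p s.
        (xconst zvar - xconst (qvar ^ t) * xvar k a) * (1 - xconst (qvar ^ t) * xvar (n-k) a))"

definition Delta :: "nat \<Rightarrow> nat \<Rightarrow> xpoly" where
  "Delta k n = (\<Prod>i\<in>{1..n-1}. \<Prod>a\<in>{1..vdim k n i}. \<Prod>b\<in>{a<..vdim k n i}. xvar i b - xvar i a)"

definition Phi :: "nat \<Rightarrow> nat \<Rightarrow> nat \<Rightarrow> nat \<Rightarrow> nat \<Rightarrow> nat \<Rightarrow> xpoly" where
  "Phi r m p k n s = Delta k n * Phi_bar r m p k n s"

definition target_monom :: "nat \<Rightarrow> nat \<Rightarrow> nat \<Rightarrow> nat \<Rightarrow> xmonom" where
  "target_monom p k n s =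
     (\<Sum>i\<in>{1..n-1}. \<Sum>j\<in>{1..vdim k n i}. Poly_Mapping.single (i, j) (j * p ^ s - 1))"

text \<open>
  The integer \<open>N\<close> may be negative; only the parity of \<open>(p\<^sup>s-1)N\<omega>\<close> matters, so its absolute value is
  used as the exponent of \<open>-1\<close>.
\<close>

definition T_poly :: "int \<Rightarrow> nat \<Rightarrow> nat \<Rightarrow> nat \<Rightarrow> nat \<Rightarrow> nat \<Rightarrow> nat \<Rightarrow> int poly poly" where
  "T_poly N r m p k n s =
     (- 1) ^ (exp_om r m p s * nat \<bar>N\<bar>)
     * Poly_Mapping.lookup (Phi r m p k n s) (target_monom p k n s)"

end

theory Submission
  imports Defs Complex_Main "HOL-Combinatorics.Transposition"
begin

text \<open>
  The polynomial \<open>[p\<^sup>s]\<^sub>q\<close> is monic with simple roots, the \<open>p\<^sup>j\<close>-th primitive roots of unity for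
  \<open>1 \<le> j \<le> s\<close>, so it suffices to check that the difference vanishes at \<open>q = \<zeta>\<close>, \<open>z = w\<close> for every such
  \<open>\<zeta>\<close> and all complex \<open>w\<close>. Put \<open>M = p\<^sup>j\<close>. As \<open>\<Prod>\<^sub>t\<^sub><\<^sub>M (X - \<zeta>\<^sup>t Y) = X\<^sup>M - Y\<^sup>M\<close> and the exponents
  satisfy \<open>e\<^sub>j\<^sub>+\<^sub>a = M e\<^sub>a + e\<^sub>j\<close>, the master polynomial at \<open>q = \<zeta>\<close> factors as
  \<open>\<Phi>\<^sub>j\<^sub>+\<^sub>a(x,w,\<zeta>) = \<Phi>\<^sub>j(x,w,\<zeta>) \<Phi>'\<^sub>a(x\<^sup>M,w\<^sup>M,1)\<close>, where \<open>\<Phi>'\<close> lacks the Vandermonde factor \<open>\<Delta>\<close>.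
  Coefficients of such a product only see the Cartier transform of \<open>\<Phi>\<^sub>j\<close>, which collects the
  coefficients of the monomials \<open>x\<^bsup>M(u+1)-1\<^esup>\<close>. It is alternating in every row of variables, and its
  degree in any selection of one variable per row is at most that of \<open>\<Delta>\<close>; hence it is a multiple of
  \<open>\<Delta>\<close>, and the factor is \<open>T\<^sub>j(w,\<zeta>)\<close>. Therefore \<open>T\<^sub>j\<^sub>+\<^sub>a(w,\<zeta>) = T\<^sub>j(w,\<zeta>) T\<^sub>a(w\<^sup>M,1)\<close>. Applied to \<open>\<zeta>\<close> and,
  with \<open>j - 1\<close> in place of \<open>j\<close>, to \<open>\<zeta>\<^sup>p\<close>, this makes both products of the theorem equal.
\<close>

section \<open>Ring homomorphisms and their action on polynomials through exponents and
  coefficients\<close>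

locale cring_hom =
  fixes H :: "'a::comm_ring_1 \<Rightarrow> 'b::comm_ring_1"
  assumes hom_1: "H 1 = 1"
    and hom_add: "H (a + b) = H a + H b"
    and hom_mult: "H (a * b) = H a * H b"
begin

lemma hom_0: "H 0 = 0"
  using hom_add[of 0 0] by simp

lemma hom_uminus: "H (- a) = - H a"
  using hom_add[of a "- a"] by (simp add: hom_0 eq_neg_iff_add_eq_0 add.commute)

lemma hom_diff: "H (a - b) = H a - H b"
  using hom_add[of a "- b"] by (simp add: hom_uminus)

lemma hom_power: "H (a ^ n) = H a ^ n"
  by (induction n) (simp_all add: hom_1 hom_mult)

lemma hom_sum: "H (sum f A) = (\<Sum>x\<in>A. H (f x))"
  by (induction A rule: infinite_finite_induct) (simp_all add: hom_0 hom_add)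

lemma hom_prod: "H (prod f A) = (\<Prod>x\<in>A. H (f x))"
  by (induction A rule: infinite_finite_induct) (simp_all add: hom_1 hom_mult)

lemma map_poly_hom: "cring_hom (map_poly H)"
proof
  show "map_poly H 1 = 1"
    by (simp add: hom_1)
  show "map_poly H (a + b) = map_poly H a + map_poly H b" for a b
    by (rule poly_eqI) (simp add: coeff_map_poly hom_0 hom_add)
  show "map_poly H (a * b) = map_poly H a * map_poly H b" for a b
    by (rule poly_eqI) (simp add: coeff_map_poly hom_0 coeff_mult hom_sum hom_mult)
qed

end

lemma cring_hom_comp: "cring_hom G \<Longrightarrow> cring_hom H \<Longrightarrow> cring_hom (\<lambda>x. G (H x))"
  by (simp add: cring_hom_def)

lemma cring_hom_poly: "cring_hom (\<lambda>f. poly f x)"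
  by unfold_locales simp_all

lemma cring_hom_of_int: "cring_hom of_int"
  by unfold_locales simp_all

lemma cring_hom_id: "cring_hom (\<lambda>x. x)"
  by unfold_locales simp_all

abbreviation lookup :: "('a \<Rightarrow>\<^sub>0 'b::zero) \<Rightarrow> 'a \<Rightarrow> 'b"
  where "lookup \<equiv> Poly_Mapping.lookup"

lemma poly_mapping_sum_single:
  "(\<Sum>k\<in>Poly_Mapping.keys P. Poly_Mapping.single k (lookup P k)) = (P :: 'm \<Rightarrow>\<^sub>0 'a::comm_monoid_add)"
  by (rule poly_mapping_eqI)
    (auto simp: lookup_sum lookup_single when_def not_in_keys_iff_lookup_eq_zero)

lemma poly_mapping_induct_single [case_names single add]:
  fixes P :: "'m \<Rightarrow>\<^sub>0 'a::comm_monoid_add"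
  assumes "\<And>k c. \<Phi> (Poly_Mapping.single k c)" "\<And>P Q. \<Phi> P \<Longrightarrow> \<Phi> Q \<Longrightarrow> \<Phi> (P + Q)"
  shows "\<Phi> P"
proof -
  have "\<Phi> 0"
    using assms(1)[of undefined 0] by simp
  have "\<Phi> (\<Sum>k\<in>A. Poly_Mapping.single k (lookup P k))" for A
    by (induction A rule: infinite_finite_induct) (simp_all add: assms \<open>\<Phi> 0\<close>)
  from this[of "Poly_Mapping.keys P"] show ?thesis
    by (simp only: poly_mapping_sum_single)
qed

text \<open>One construction for three substitutions: specializing the coefficients
  (\<open>g\<close> the identity), raising the variables to a power (\<open>g = scale M\<close>) and
  permuting the variables (\<open>g = perm_vars \<tau>\<close>).\<close>

definition mono_hom :: "('m \<Rightarrow> 'n) \<Rightarrow> ('a \<Rightarrow> 'b) \<Rightarrow> ('m \<Rightarrow>\<^sub>0 'a::comm_ring_1) \<Rightarrow> ('n \<Rightarrow>\<^sub>0 'b::comm_ring_1)"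
  where "mono_hom g h P = (\<Sum>k\<in>Poly_Mapping.keys P. Poly_Mapping.single (g k) (h (lookup P k)))"

lemma mono_hom_single: "h 0 = 0 \<Longrightarrow> mono_hom g h (Poly_Mapping.single k c) = Poly_Mapping.single (g k) (h c)"
  by (simp add: mono_hom_def)

lemma mono_hom_add:
  assumes "cring_hom h"
  shows "mono_hom g h (P + Q) = mono_hom g h P + mono_hom g h Q"
proof -
  interpret cring_hom h by fact
  show ?thesis
    unfolding mono_hom_def
    by (rule setsum_keys_plus_distrib) (simp_all add: hom_0 hom_add single_add)
qed

lemma cring_hom_mono_hom:
  fixes g :: "'m::comm_monoid_add \<Rightarrow> 'n::comm_monoid_add"
  assumes "cring_hom h" "g 0 = 0" "\<And>a b. g (a + b) = g a + g b"
  shows "cring_hom (mono_hom g h)"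
proof -
  interpret h: cring_hom h by fact
  show ?thesis
  proof
    show "mono_hom g h 1 = 1"
      using mono_hom_single[of h g 0 1] by (simp add: h.hom_0 h.hom_1 assms)
    show "mono_hom g h (P + Q) = mono_hom g h P + mono_hom g h Q" for P Q
      by (rule mono_hom_add) fact
    show "mono_hom g h (P * Q) = mono_hom g h P * mono_hom g h Q" for P Q
    proof (induction P rule: poly_mapping_induct_single)
      case (single k c)
      show ?case
        by (induction Q rule: poly_mapping_induct_single)
          (simp_all add: mult_single mono_hom_single h.hom_0 assms h.hom_mult distrib_left mono_hom_add)
    qed (simp add: distrib_right mono_hom_add assms)
  qed
qed

text \<open>Injectivity of \<open>g\<close> keeps distinct monomials from merging, so no
  coefficients are added up.\<close>

lemma lookup_mono_hom:
  assumes "cring_hom h" "inj g"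
  shows "lookup (mono_hom g h P) (g k) = h (lookup P k)"
proof -
  interpret h: cring_hom h by fact
  show ?thesis
    by (induction P rule: poly_mapping_induct_single)
      (auto simp: mono_hom_single lookup_single when_def h.hom_0 h.hom_add lookup_add
         mono_hom_add assms inj_eq)
qed

section \<open>The master polynomial over an arbitrary ring: factorization and symmetry\<close>

definition qpoch :: "'r::comm_ring_1 \<Rightarrow> 'r \<Rightarrow> 'r \<Rightarrow> nat \<Rightarrow> 'r" where
  "qpoch Q A B e = (\<Prod>t<e. A - Q ^ t * B)"

text \<open>\<open>Phi_bar\<close> with ring, exponents, variables and parameters left free, so that
  a homomorphism acts on the arguments alone and \<open>x^M\<close>, \<open>w^M\<close>,
  \<open>1\<close> can be substituted for \<open>x\<close>, \<open>z\<close>,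
  \<open>q\<close>.\<close>

definition master :: "nat \<Rightarrow> nat \<Rightarrow> nat \<Rightarrow> nat \<Rightarrow> nat \<Rightarrow> (nat \<Rightarrow> nat \<Rightarrow> 'r) \<Rightarrow> 'r \<Rightarrow> 'r \<Rightarrow> 'r::comm_ring_1" where
  "master k n e1 e2 e3 X Z Q =
     (\<Prod>i\<in>{1..n-1}. \<Prod>j\<in>{1..vdim k n i}. X i j) ^ e1
   * (\<Prod>i\<in>{1..n-1}. \<Prod>a\<in>{1..vdim k n i}. \<Prod>b\<in>{1..vdim k n i} - {a}. qpoch Q (X i a) (X i b) e2)
   * (\<Prod>i\<in>{1..n-2}. \<Prod>a\<in>{1..vdim k n i}. \<Prod>b\<in>{1..vdim k n (i+1)}. qpoch Q (X i a) (X (i+1) b) e3)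
   * (\<Prod>a\<in>{1..k}. qpoch Q Z (X k a) e3 * qpoch Q 1 (X (n-k) a) e3)"

definition vdm :: "nat \<Rightarrow> nat \<Rightarrow> (nat \<Rightarrow> nat \<Rightarrow> 'r) \<Rightarrow> 'r::comm_ring_1" where
  "vdm k n X = (\<Prod>i\<in>{1..n-1}. \<Prod>a\<in>{1..vdim k n i}. \<Prod>b\<in>{a<..vdim k n i}. X i b - X i a)"

lemma (in cring_hom) hom_qpoch: "H (qpoch Q A B e) = qpoch (H Q) (H A) (H B) e"
  by (simp add: qpoch_def hom_prod hom_diff hom_mult hom_power)

lemma (in cring_hom) hom_master:
  "H (master k n e1 e2 e3 X Z Q) = master k n e1 e2 e3 (\<lambda>i a. H (X i a)) (H Z) (H Q)"
  by (simp add: master_def hom_prod hom_mult hom_power hom_qpoch hom_1)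

lemma (in cring_hom) hom_vdm: "H (vdm k n X) = vdm k n (\<lambda>i a. H (X i a))"
  by (simp add: vdm_def hom_prod hom_diff)

text \<open>With \<open>Q ^ M = 1\<close> the factors are periodic in \<open>t\<close>: each full
  period multiplies to \<open>A ^ M - B ^ M\<close>, which is also one factor of
  \<open>qpoch\<close> at \<open>Q = 1\<close> in the \<open>M\<close>-th powers. The induction
  removes one period at a time. The product over a period is a hypothesis here;
  \<open>qpoch_primitive_root\<close> supplies it.\<close>

lemma qpoch_root_of_unity:
  fixes Q :: "'r::comm_ring_1"
  assumes "\<And>A B. qpoch Q A B M = A ^ M - B ^ M" "Q ^ M = 1"
  shows "qpoch Q A B (M * e' + e) = qpoch Q A B e * qpoch 1 (A ^ M) (B ^ M) e'"
proof (induction e')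
  case 0
  then show ?case by (simp add: qpoch_def)
next
  case (Suc e')
  have "qpoch Q A B (M + f) = (A ^ M - B ^ M) * qpoch Q A B f" for f
  proof -
    have "qpoch Q A B (M + f) = qpoch Q A B M * (\<Prod>t<f. A - Q ^ (M + t) * B)"
      by (induction f) (simp_all add: qpoch_def mult.assoc)
    also have "\<dots> = (A ^ M - B ^ M) * (\<Prod>t<f. A - Q ^ (M + t) * B)"
      by (simp only: assms(1))
    also have "(\<Prod>t<f. A - Q ^ (M + t) * B) = qpoch Q A B f"
      by (simp add: qpoch_def power_add assms(2))
    finally show ?thesis .
  qed
  from this[of "M * e' + e"] show ?case
    by (simp add: Suc add.assoc) (simp add: qpoch_def mult_ac)
qed

lemma master_root_of_unity:
  fixes Q :: "'r::comm_ring_1"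
  assumes "\<And>A B. qpoch Q A B M = A ^ M - B ^ M" "Q ^ M = 1"
  shows "master k n (M * e1' + e1) (M * e2' + e2) (M * e3' + e3) X Z Q =
    master k n e1 e2 e3 X Z Q * master k n e1' e2' e3' (\<lambda>i a. X i a ^ M) (Z ^ M) 1"
proof -
  note qp = qpoch_root_of_unity[OF assms]
  \<comment> \<open>The literal \<open>1\<close> in the end factors of \<open>master\<close> takes
    the place of \<open>1 ^ M\<close>.\<close>
  have "qpoch Q 1 B (M * e' + e) = qpoch Q 1 B e * qpoch 1 1 (B ^ M) e'" for B e e'
    using qp[of 1] by simp
  then show ?thesis
    unfolding master_def qp power_one prod.distrib power_add power_mult prod_power_distrib
    by (simp only: mult_ac)
qed

lemma prod_permutes:
  assumes "bij_betw \<sigma> A A"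
  shows "(\<Prod>a\<in>A. f (\<sigma> a)) = prod f A"
  using prod.reindex_bij_betw[OF assms] .

text \<open>The permutations may differ from row to row: every group of factors runs over whole rows
  or over all ordered pairs of distinct indices, so reindexing restores it.\<close>

lemma master_permute:
  assumes kn: "0 < k" "2 * k \<le> n"
    and \<sigma>: "\<And>i. i \<in> {1..n-1} \<Longrightarrow> bij_betw (\<sigma> i) {1..vdim k n i} {1..vdim k n i}"
  shows "master k n e1 e2 e3 (\<lambda>i a. X i (\<sigma> i a)) Z Q = master k n e1 e2 e3 X Z Q"
proof -
  have 1: "(\<Prod>i\<in>{1..n-1}. \<Prod>j\<in>{1..vdim k n i}. X i (\<sigma> i j)) = (\<Prod>i\<in>{1..n-1}. \<Prod>j\<in>{1..vdim k n i}. X i j)"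
    by (rule prod.cong[OF refl], rule prod_permutes, rule \<sigma>)
  have 2: "(\<Prod>a\<in>{1..vdim k n i}. \<Prod>b\<in>{1..vdim k n i} - {a}. F (\<sigma> i a) (\<sigma> i b)) =
      (\<Prod>a\<in>{1..vdim k n i}. \<Prod>b\<in>{1..vdim k n i} - {a}. F a b)" if i: "i \<in> {1..n-1}" for i and F :: "nat \<Rightarrow> nat \<Rightarrow> 'a"
  proof -
    have "(\<Prod>b\<in>{1..vdim k n i} - {a}. F (\<sigma> i a) (\<sigma> i b)) = (\<Prod>b\<in>{1..vdim k n i} - {\<sigma> i a}. F (\<sigma> i a) b)"
      if a: "a \<in> {1..vdim k n i}" for a
    proof (rule prod.reindex_bij_betw)
      have "bij_betw (\<sigma> i) ({1..vdim k n i} - {a}) (\<sigma> i ` ({1..vdim k n i} - {a}))"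
        using \<sigma>[OF i] by (meson Diff_subset bij_betw_subset)
      moreover have "\<sigma> i ` ({1..vdim k n i} - {a}) = {1..vdim k n i} - {\<sigma> i a}"
        using \<sigma>[OF i] a by (simp add: bij_betw_def inj_on_image_set_diff[where C="{1..vdim k n i}"])
      ultimately show "bij_betw (\<sigma> i) ({1..vdim k n i} - {a}) ({1..vdim k n i} - {\<sigma> i a})"
        by simp
    qed
    then have "(\<Prod>a\<in>{1..vdim k n i}. \<Prod>b\<in>{1..vdim k n i} - {a}. F (\<sigma> i a) (\<sigma> i b)) =
      (\<Prod>a\<in>{1..vdim k n i}. \<Prod>b\<in>{1..vdim k n i} - {\<sigma> i a}. F (\<sigma> i a) b)"
      by (rule prod.cong[OF refl])
    also have "\<dots> = (\<Prod>a\<in>{1..vdim k n i}. \<Prod>b\<in>{1..vdim k n i} - {a}. F a b)"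
      by (rule prod_permutes, rule \<sigma>[OF i])
    finally show ?thesis .
  qed
  have 3: "(\<Prod>a\<in>{1..vdim k n i}. \<Prod>b\<in>{1..vdim k n (i+1)}. F (\<sigma> i a) (\<sigma> (i+1) b)) =
      (\<Prod>a\<in>{1..vdim k n i}. \<Prod>b\<in>{1..vdim k n (i+1)}. F a b)" if "i \<in> {1..n-2}" for i and F :: "nat \<Rightarrow> nat \<Rightarrow> 'a"
  proof -
    have i: "i \<in> {1..n-1}" "i + 1 \<in> {1..n-1}"
      using that by auto
    have "(\<Prod>b\<in>{1..vdim k n (i+1)}. F a (\<sigma> (i+1) b)) = (\<Prod>b\<in>{1..vdim k n (i+1)}. F a b)" for a
      by (rule prod_permutes, rule \<sigma>[OF i(2)])
    then show ?thesis
      using prod_permutes[OF \<sigma>[OF i(1)], of "\<lambda>a. \<Prod>b\<in>{1..vdim k n (i+1)}. F a b"] by simp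
  qed
  \<comment> \<open>The rows \<open>k\<close> and \<open>n - k\<close> have exactly \<open>k\<close>
    variables, so the end factors run over whole rows as well.\<close>
  have 4: "(\<Prod>a\<in>{1..k}. F (\<sigma> i a)) = (\<Prod>a\<in>{1..k}. F a)" if "i = k \<or> i = n - k" for i and F :: "nat \<Rightarrow> 'a"
  proof -
    have "i \<in> {1..n-1}" "vdim k n i = k"
      using that kn by (auto simp: vdim_def)
    with \<sigma>[of i] show ?thesis
      using prod_permutes by auto
  qed
  show ?thesis
    unfolding master_def prod.distrib
  proof (intro arg_cong2[where f="(*)"])
    show "(\<Prod>i\<in>{1..n-1}. \<Prod>j\<in>{1..vdim k n i}. X i (\<sigma> i j)) ^ e1 =
        (\<Prod>i\<in>{1..n-1}. \<Prod>j\<in>{1..vdim k n i}. X i j) ^ e1"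
      by (simp only: 1)
    show "(\<Prod>i\<in>{1..n-1}. \<Prod>a\<in>{1..vdim k n i}. \<Prod>b\<in>{1..vdim k n i} - {a}. qpoch Q (X i (\<sigma> i a)) (X i (\<sigma> i b)) e2) =
        (\<Prod>i\<in>{1..n-1}. \<Prod>a\<in>{1..vdim k n i}. \<Prod>b\<in>{1..vdim k n i} - {a}. qpoch Q (X i a) (X i b) e2)"
      by (rule prod.cong[OF refl], rule 2)
    show "(\<Prod>i\<in>{1..n-2}. \<Prod>a\<in>{1..vdim k n i}. \<Prod>b\<in>{1..vdim k n (i+1)}. qpoch Q (X i (\<sigma> i a)) (X (i+1) (\<sigma> (i+1) b)) e3) =
        (\<Prod>i\<in>{1..n-2}. \<Prod>a\<in>{1..vdim k n i}. \<Prod>b\<in>{1..vdim k n (i+1)}. qpoch Q (X i a) (X (i+1) b) e3)"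
      by (rule prod.cong[OF refl], rule 3)
    show "(\<Prod>a\<in>{1..k}. qpoch Q Z (X k (\<sigma> k a)) e3) = (\<Prod>a\<in>{1..k}. qpoch Q Z (X k a) e3)"
      by (rule 4) simp
    show "(\<Prod>a\<in>{1..k}. qpoch Q 1 (X (n-k) (\<sigma> (n-k) a)) e3) = (\<Prod>a\<in>{1..k}. qpoch Q 1 (X (n-k) a) e3)"
      by (rule 4) simp
  qed
qed

section \<open>The product formula at a primitive root of unity\<close>

lemma homogenize_linear_factor:
  fixes h :: "'a::comm_ring_1 \<Rightarrow> 'r::comm_ring_1"
  assumes "cring_hom h" "degree P \<le> n"
  shows "(\<Sum>i\<le>Suc n. h (coeff ([:- c, 1:] * P) i) * A ^ i * B ^ (Suc n - i)) =
    (A - h c * B) * (\<Sum>i\<le>n. h (coeff P i) * A ^ i * B ^ (n - i))"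
proof -
  interpret cring_hom h by fact
  have "(\<Sum>i\<le>Suc n. h (coeff (pCons 0 P) i) * A ^ i * B ^ (Suc n - i)) =
      A * (\<Sum>i\<le>n. h (coeff P i) * A ^ i * B ^ (n - i))"
    by (simp add: sum.atMost_Suc_shift hom_0 sum_distrib_left mult_ac del: sum.atMost_Suc)
  moreover have "(\<Sum>i\<le>Suc n. h (coeff (smult c P) i) * A ^ i * B ^ (Suc n - i)) =
      h c * B * (\<Sum>i\<le>n. h (coeff P i) * A ^ i * B ^ (n - i))"
  proof -
    have "(\<Sum>i\<le>Suc n. h (coeff (smult c P) i) * A ^ i * B ^ (Suc n - i)) =
        (\<Sum>i\<le>n. h (coeff (smult c P) i) * A ^ i * B ^ (Suc n - i))"
      using assms(2) by (simp add: hom_0 coeff_eq_0)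
    also have "\<dots> = (\<Sum>i\<le>n. h c * B * (h (coeff P i) * A ^ i * B ^ (n - i)))"
      by (rule sum.cong) (simp_all add: hom_mult Suc_diff_le)
    finally show ?thesis
      by (simp only: sum_distrib_left)
  qed
  moreover have "[:- c, 1:] * P = pCons 0 P - smult c P"
    by simp
  ultimately show ?thesis
    by (simp only: coeff_diff hom_diff left_diff_distrib sum_subtractf)
qed

text \<open>A product of linear forms is the homogenization of a one-variable polynomial. An
  identity found over the complex numbers by counting roots thus passes along \<open>h\<close> to
  arbitrary \<open>A\<close> and \<open>B\<close> of another ring.\<close>

lemma homogenize_prod_linear:
  fixes h :: "'a::comm_ring_1 \<Rightarrow> 'r::comm_ring_1"
  assumes "cring_hom h"
  shows "(\<Prod>t<n. A - h (c t) * B) =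
    (\<Sum>i\<le>n. h (coeff (\<Prod>t<n. [:- c t, 1:]) i) * A ^ i * B ^ (n - i))"
proof (induction n)
  case 0
  interpret cring_hom h by fact
  show ?case by (simp add: hom_1)
next
  case (Suc n)
  have "degree (\<Prod>t<n. [:- c t, 1:]) \<le> n"
    by (rule order.trans[OF degree_prod_sum_le]) (simp_all add: sum.neutral)
  note step = homogenize_linear_factor[OF assms this, of "c n" A B, symmetric]
  have "(\<Prod>t<Suc n. A - h (c t) * B) = (A - h (c n) * B) * (\<Prod>t<n. A - h (c t) * B)"
    by (simp add: mult.commute)
  also note Suc
  also note step
  also have "[:- c n, 1:] * (\<Prod>t<n. [:- c t, 1:]) = (\<Prod>t<Suc n. [:- c t, 1:])"
    by (simp only: prod.lessThan_Suc mult.commute)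
  finally show ?case .
qed

definition primitive_root_of_unity :: "nat \<Rightarrow> complex \<Rightarrow> bool" where
  "primitive_root_of_unity M \<zeta> \<longleftrightarrow> 0 < M \<and> \<zeta> ^ M = 1 \<and> (\<forall>t. 0 < t \<and> t < M \<longrightarrow> \<zeta> ^ t \<noteq> 1)"

text \<open>Both sides have degree at most \<open>M\<close> and the same coefficient at
  \<open>M\<close>, and both vanish at the \<open>M\<close> distinct powers of \<zeta>.\<close>

lemma prod_primitive_root:
  assumes "primitive_root_of_unity M \<zeta>"
  shows "(\<Prod>t<M. [:- (\<zeta> ^ t), 1:]) = monom 1 M - 1"
proof (rule poly_eqI_degree_lead_coeff[where A = "(\<lambda>t. \<zeta> ^ t) ` {..<M}" and n = M])
  have M: "0 < M" "\<zeta> ^ M = 1" and prim: "\<And>t. 0 < t \<Longrightarrow> t < M \<Longrightarrow> \<zeta> ^ t \<noteq> 1"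
    using assms by (auto simp: primitive_root_of_unity_def)
  have "\<zeta> \<noteq> 0"
    using M by (metis power_0_left zero_neq_one not_gr_zero)
  have "a = b" if "a \<le> b" "b < M" "\<zeta> ^ a = \<zeta> ^ b" for a b
  proof (rule ccontr)
    assume "a \<noteq> b"
    have "\<zeta> ^ a * \<zeta> ^ (b - a) = \<zeta> ^ a"
      using that by (metis le_add_diff_inverse power_add)
    then have "\<zeta> ^ (b - a) = 1"
      using \<open>\<zeta> \<noteq> 0\<close> by simp
    moreover have "0 < b - a" "b - a < M"
      using \<open>a \<noteq> b\<close> that by auto
    ultimately show False
      using prim by blast
  qed
  then have "inj_on (\<lambda>t. \<zeta> ^ t) {..<M}"
    by (intro inj_onI) (metis lessThan_iff linear)
  then show "M \<le> card ((\<lambda>t. \<zeta> ^ t) ` {..<M})"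
    by (simp add: card_image)
  show "degree (\<Prod>t<M. [:- (\<zeta> ^ t), 1:]) \<le> M"
    by (rule order.trans[OF degree_prod_sum_le]) (simp_all add: sum.neutral)
  show "degree (monom 1 M - 1 :: complex poly) \<le> M"
    by (intro degree_diff_le) (simp_all add: degree_monom_le)
  have "lead_coeff (\<Prod>t<M. [:- (\<zeta> ^ t), 1:]) = 1"
    by (simp add: lead_coeff_prod)
  moreover have "degree (\<Prod>t<M. [:- (\<zeta> ^ t), 1:]) = M"
    by (subst degree_prod_eq_sum_degree) auto
  ultimately show "coeff (\<Prod>t<M. [:- (\<zeta> ^ t), 1:]) M = coeff (monom 1 M - 1) M"
    using M by simp
  show "poly (\<Prod>t<M. [:- (\<zeta> ^ t), 1:]) x = poly (monom 1 M - 1) x"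
    if "x \<in> (\<lambda>t. \<zeta> ^ t) ` {..<M}" for x
  proof -
    from that obtain t where t: "t < M" "x = \<zeta> ^ t"
      by auto
    have "x ^ M = 1"
      unfolding t by (metis M(2) mult.commute power_mult power_one)
    with t show ?thesis
      by (auto simp: poly_prod poly_monom prod_zero_iff)
  qed
qed

lemma qpoch_primitive_root:
  fixes h :: "complex \<Rightarrow> 'r::comm_ring_1"
  assumes "cring_hom h" "primitive_root_of_unity M \<zeta>"
  shows "qpoch (h \<zeta>) A B M = A ^ M - B ^ M"
proof -
  interpret cring_hom h by fact
  have "0 < M"
    using assms by (simp add: primitive_root_of_unity_def)
  have "qpoch (h \<zeta>) A B M = (\<Sum>i\<le>M. h (coeff (monom 1 M - 1) i) * A ^ i * B ^ (M - i))"
    by (simp add: qpoch_def flip: hom_power homogenize_prod_linear[OF assms(1)] prod_primitive_root[OF assms(2)])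
  also have "\<dots> = (\<Sum>i\<le>M. (if i = M then A ^ M else 0) - (if i = 0 then B ^ M else 0))"
    using \<open>0 < M\<close> by (intro sum.cong refl) (auto simp: hom_diff hom_0 hom_1 hom_uminus coeff_1 coeff_monom)
  also have "\<dots> = A ^ M - B ^ M"
    by (simp add: sum_subtractf)
  finally show ?thesis .
qed

section \<open>The substitution of \<open>x^M\<close> for \<open>x\<close> and the Cartier
  transform\<close>

definition scale :: "nat \<Rightarrow> ('v \<Rightarrow>\<^sub>0 nat) \<Rightarrow> 'v \<Rightarrow>\<^sub>0 nat" where
  "scale M = Poly_Mapping.map ((*) M)"

lemma lookup_scale [simp]: "lookup (scale M u) v = M * lookup u v"
  by (simp add: scale_def Poly_Mapping.map.rep_eq when_def)

lemma scale_0 [simp]: "scale M 0 = 0"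
  by (rule poly_mapping_eqI) simp

lemma scale_add: "scale M (a + b) = scale M a + scale M b"
  by (rule poly_mapping_eqI) (simp add: lookup_add distrib_left)

lemma scale_single: "scale M (Poly_Mapping.single v e) = Poly_Mapping.single v (M * e)"
  by (rule poly_mapping_eqI) (simp add: lookup_single when_def)

lemma inj_scale_add: "0 < M \<Longrightarrow> inj (\<lambda>u. scale M u + c)"
  by (auto simp: inj_def poly_mapping_eq_iff fun_eq_iff lookup_add)

lemma scale_eq_iff [simp]: "0 < M \<Longrightarrow> scale M u = scale M u' \<longleftrightarrow> u = u'"
  by (auto simp: poly_mapping_eq_iff fun_eq_iff)

text \<open>An analogue of the Cartier operator: a left inverse of substituting \<open>x^M\<close>
  and then multiplying by \<open>x^c\<close>. \<open>map_key\<close> composes with injective maps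
  only, hence \<open>0 < M\<close> in the rules below.\<close>

definition cartier :: "nat \<Rightarrow> ('v \<Rightarrow>\<^sub>0 nat) \<Rightarrow> (('v \<Rightarrow>\<^sub>0 nat) \<Rightarrow>\<^sub>0 'a) \<Rightarrow> ('v \<Rightarrow>\<^sub>0 nat) \<Rightarrow>\<^sub>0 'a::zero" where
  "cartier M c A = Poly_Mapping.map_key (\<lambda>u. scale M u + c) A"

lemma lookup_cartier: "0 < M \<Longrightarrow> lookup (cartier M c A) u = lookup A (scale M u + c)"
  by (simp add: cartier_def map_key.rep_eq inj_scale_add)

lemma cartier_add: "0 < M \<Longrightarrow> cartier M c (A + B :: _ \<Rightarrow>\<^sub>0 'a::monoid_add) = cartier M c A + cartier M c B"
  by (rule poly_mapping_eqI) (simp add: lookup_cartier lookup_add)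

text \<open>Compare coordinates modulo \<open>M\<close>: as the entries of \<open>c\<close> lie
  below \<open>M\<close>, an entry of \<open>f\<close> above that of \<open>t\<close> would make the
  left side too large, so \<open>u = t - f\<close> is the quotient.\<close>

lemma scale_add_eq_iff:
  assumes "\<And>v. lookup c v < M"
  shows "e + scale M f = scale M t + c \<longleftrightarrow> (\<exists>u. e = scale M u + c \<and> u + f = t)"
proof
  assume eq: "e + scale M f = scale M t + c"
  have pt: "lookup e v + M * lookup f v =
      M * lookup t v + lookup c v" for v
    using arg_cong[OF eq, of "\<lambda>m. lookup m v"] by (simp add: lookup_add)
  have le: "lookup f v \<le> lookup t v" for v
  proof (rule ccontr)
    assume "\<not> ?thesis"
    then have "M * (lookup t v + 1) \<le> M * lookup f v"
      by (intro mult_le_mono2) simp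
    with pt[of v] assms[of v] show False
      by simp
  qed
  have "lookup e v = M * (lookup t v - lookup f v) + lookup c v" for v
    using pt[of v] mult_le_mono2[OF le[of v], of M] by (simp add: diff_mult_distrib2)
  then have "e = scale M (t - f) + c"
    by (intro poly_mapping_eqI) (simp add: lookup_add lookup_minus)
  moreover have "(t - f) + f = t"
    using le by (intro poly_mapping_eqI) (simp add: lookup_add lookup_minus)
  ultimately show "\<exists>u. e = scale M u + c \<and> u + f = t"
    by blast
qed (auto simp: scale_add ac_simps)

lemma cartier_single:
  assumes "0 < M"
  shows "cartier M c (Poly_Mapping.single (scale M u + c) a) = Poly_Mapping.single u a"
  by (intro poly_mapping_eqI) (simp add: lookup_cartier assms lookup_single when_def)

lemma cartier_single_0:
  assumes "0 < M" "\<And>u. e \<noteq> scale M u + c"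
  shows "cartier M c (Poly_Mapping.single e a) = 0"
  by (intro poly_mapping_eqI) (simp add: lookup_cartier assms lookup_single when_def)

text \<open>The projection formula: a factor in the variables \<open>x^M\<close> passes through the
  Cartier transform. Both sides are bilinear, so single monomials suffice, and
  \<open>scale_add_eq_iff\<close> decides there.\<close>

lemma lookup_mult_frobenius:
  fixes A B :: "('v \<Rightarrow>\<^sub>0 nat) \<Rightarrow>\<^sub>0 'a::comm_ring_1"
  assumes c: "\<And>v. lookup c v < M"
  shows "lookup (A * mono_hom (scale M) (\<lambda>x. x) B) (scale M t + c) =
    lookup (cartier M c A * B) t"
proof -
  have M: "0 < M"
    using c[of undefined] by simp
  show ?thesis
  proof (induction A rule: poly_mapping_induct_single)
    case (single e a)
    show ?case
    proof (induction B rule: poly_mapping_induct_single)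
      case (single f b)
      show ?case
      proof (cases "\<exists>u. e = scale M u + c")
        case True
        then obtain u where u: "e = scale M u + c"
          by blast
        have "e + scale M f = scale M t + c \<longleftrightarrow> u + f = t"
          using scale_add_eq_iff[OF c, of e f t] M by (auto simp: u)
        then show ?thesis
          by (simp add: mono_hom_single mult_single cartier_single M lookup_single when_def u)
      next
        case False
        then show ?thesis
          using scale_add_eq_iff[OF c, of e f t]
          by (auto simp add: mono_hom_single mult_single cartier_single_0 M lookup_single when_def)
      qed
    qed (simp add: mono_hom_add cring_hom_id distrib_left lookup_add)
  qed (simp add: cartier_add M distrib_right lookup_add)
qed

section \<open>Degree in a selection of one variable per row\<close>

text \<open>\<open>xx\<close> and \<open>xc\<close> are \<open>xvar\<close> and
  \<open>xconst\<close> over any coefficient ring, so that the same expressions exist before and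
  after \<open>z\<close> and \<open>q\<close> are specialized.\<close>

definition xx :: "nat \<Rightarrow> nat \<Rightarrow> xmonom \<Rightarrow>\<^sub>0 'a::comm_ring_1" where
  "xx i j = Poly_Mapping.single (Poly_Mapping.single (i, j) 1) 1"

definition xc :: "'a \<Rightarrow> xmonom \<Rightarrow>\<^sub>0 'a::comm_ring_1" where
  "xc c = Poly_Mapping.single 0 c"

lemma cring_hom_xc: "cring_hom xc"
  by unfold_locales (simp_all add: xc_def single_add mult_single)

definition weight :: "'v set \<Rightarrow> ('v \<Rightarrow>\<^sub>0 nat) \<Rightarrow> nat" where
  "weight S m = (\<Sum>v\<in>S. lookup m v)"

definition deg_le :: "'v set \<Rightarrow> nat \<Rightarrow> (('v \<Rightarrow>\<^sub>0 nat) \<Rightarrow>\<^sub>0 'a::zero) \<Rightarrow> bool" where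
  "deg_le S D P \<longleftrightarrow> (\<forall>m. lookup P m \<noteq> 0 \<longrightarrow> weight S m \<le> D)"

lemma weight_add: "weight S (m + m') = weight S m + weight S m'"
  by (simp add: weight_def lookup_add sum.distrib)

lemma deg_le_mono: "deg_le S D P \<Longrightarrow> D \<le> D' \<Longrightarrow> deg_le S D' P"
  by (auto simp: deg_le_def intro: order.trans)

lemma deg_le_xx: "finite S \<Longrightarrow> deg_le S (of_bool ((i, j) \<in> S)) (xx i j)"
  by (auto simp: deg_le_def xx_def lookup_single when_def weight_def)

lemma deg_le_xc: "deg_le S D (xc c)"
  by (auto simp: deg_le_def xc_def lookup_single when_def weight_def)

lemma deg_le_one: "deg_le S D 1"
  by (auto simp: deg_le_def lookup_one when_def weight_def)

lemma deg_le_diff: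
  fixes P Q :: "_ \<Rightarrow>\<^sub>0 'a::ab_group_add"
  shows "deg_le S D P \<Longrightarrow> deg_le S D Q \<Longrightarrow> deg_le S D (P - Q)"
  by (auto simp: deg_le_def lookup_minus) (metis diff_zero)

lemma deg_le_mult:
  fixes P Q :: "_ \<Rightarrow>\<^sub>0 'a::comm_ring_1"
  assumes "deg_le S D P" "deg_le S D' Q"
  shows "deg_le S (D + D') (P * Q)"
  unfolding deg_le_def
proof (intro allI impI)
  fix m
  assume "lookup (P * Q) m \<noteq> 0"
  then obtain a b where "m = a + b" "lookup P a \<noteq> 0" "lookup Q b \<noteq> 0"
    using keys_mult[of P Q] by (auto simp: in_keys_iff)
  with assms show "weight S m \<le> D + D'"
    by (simp add: deg_le_def weight_add add_mono)
qed

lemma deg_le_prod: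
  fixes f :: "'b \<Rightarrow> _ \<Rightarrow>\<^sub>0 'a::comm_ring_1"
  assumes "\<And>i. i \<in> I \<Longrightarrow> deg_le S (D i) (f i)"
  shows "deg_le S (sum D I) (prod f I)"
  using assms
  by (induction I rule: infinite_finite_induct) (simp_all add: deg_le_one deg_le_mult)

lemma deg_le_power:
  fixes P :: "_ \<Rightarrow>\<^sub>0 'a::comm_ring_1"
  assumes "deg_le S D P"
  shows "deg_le S (D * e) (P ^ e)"
  using deg_le_prod[of "{..<e}" S "\<lambda>_. D" "\<lambda>_. P"] assms by (simp add: mult.commute)

lemma deg_le_qpoch:
  assumes "deg_le S D A" "deg_le S D B"
  shows "deg_le S (D * e) (qpoch (xc q) A B e)"
proof -
  have "deg_le S D (A - xc q ^ t * B)" for t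
    using deg_le_mult[OF deg_le_power[OF deg_le_xc[of S 0 q], of t] assms(2)]
    by (intro deg_le_diff assms) simp
  then show ?thesis
    unfolding qpoch_def
    using deg_le_prod[of "{..<e}" S "\<lambda>_. D" "\<lambda>t. A - xc q ^ t * B"] by (simp add: mult.commute)
qed

text \<open>This count and the next two give the number of factors of a product that contain a
  selected variable, and thus its degree in the selection. Here \<open>c\<close> has
  \<open>card R - 1\<close> partners in either position.\<close>

lemma sum_pairs_touching:
  assumes "finite R" "c \<in> R"
  shows "(\<Sum>a\<in>R. \<Sum>b\<in>R - {a}. of_bool (a = c \<or> b = c)) = 2 * (card R - 1)"
proof -
  have "(\<Sum>b\<in>R - {a}. of_bool (a = c \<or> b = c)) = (if a = c then card R - 1 else 1)" if "a \<in> R" for a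
  proof (cases "a = c")
    case False
    then have "(\<Sum>b\<in>R - {a}. of_bool (b = c)) = (1::nat)"
      using assms by (simp add: of_bool_def)
    with False show ?thesis by simp
  qed (use assms in simp)
  then have "(\<Sum>a\<in>R. \<Sum>b\<in>R - {a}. of_bool (a = c \<or> b = c)) = (\<Sum>a\<in>R. if a = c then card R - 1 else 1)"
    by (rule sum.cong[OF refl])
  also have "\<dots> = card R - 1 + (\<Sum>a\<in>R - {c}. 1)"
    using assms by (simp add: sum.remove)
  finally show ?thesis
    using assms by simp
qed

text \<open>The pair \<open>(c, c')\<close> counts once: a factor that contains the selected
  variables of both rows still has degree one in the selection.\<close>

lemma sum_product_touching:
  assumes "finite R" "c \<in> R" "finite R'" "c' \<in> R'"
  shows "(\<Sum>a\<in>R. \<Sum>b\<in>R'. of_bool (a = c \<or> b = c')) = card R + card R' - 1"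
proof -
  have "(\<Sum>b\<in>R'. of_bool (a = c \<or> b = c')) = (if a = c then card R' else 1)" for a
    using assms by (simp add: of_bool_def)
  then have "(\<Sum>a\<in>R. \<Sum>b\<in>R'. of_bool (a = c \<or> b = c')) = (\<Sum>a\<in>R. if a = c then card R' else 1)"
    by simp
  also have "\<dots> = card R' + (\<Sum>a\<in>R - {c}. 1)"
    using assms by (simp add: sum.remove)
  finally show ?thesis
    using assms card_gt_0_iff[of R] by auto
qed

lemma sum_increasing_pairs_touching:
  fixes c v :: nat
  assumes "c \<in> {1..v}"
  shows "(\<Sum>a\<in>{1..v}. \<Sum>b\<in>{a<..v}. of_bool (a = c \<or> b = c)) = v - 1"
proof -
  have "(\<Sum>b\<in>{a<..v}. of_bool (a = c \<or> b = c)) = (if a = c then v - c else of_bool (a < c))" for a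
    using assms by (cases "a = c") (simp_all add: of_bool_def)
  then have "(\<Sum>a\<in>{1..v}. \<Sum>b\<in>{a<..v}. of_bool (a = c \<or> b = c)) =
      (\<Sum>a\<in>{1..v}. if a = c then v - c else of_bool (a < c))"
    by simp
  also have "\<dots> = v - c + (\<Sum>a\<in>{1..v} - {c}. of_bool (a < c))"
    using assms by (simp add: sum.remove)
  also have "(\<Sum>a\<in>{1..v} - {c}. of_bool (a < c)) = (\<Sum>a\<in>{1..<c}. 1::nat)"
    using assms by (intro sum.mono_neutral_cong_right) auto
  finally show ?thesis
    using assms by simp
qed

text \<open>Membership of index pairs outside the rows is left open, so \<open>S\<close> may contain
  such a pair; \<open>alternating_staircase_zero\<close> uses this to exclude stray
  variables.\<close>

definition is_section :: "nat \<Rightarrow> nat \<Rightarrow> (nat \<times> nat) set \<Rightarrow> (nat \<Rightarrow> nat) \<Rightarrow> bool" where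
  "is_section k n S c \<longleftrightarrow> finite S \<and> (\<forall>i\<in>{1..n-1}. c i \<in> {1..vdim k n i}) \<and>
    (\<forall>i\<in>{1..n-1}. \<forall>j\<in>{1..vdim k n i}. (i, j) \<in> S \<longleftrightarrow> j = c i)"

lemma deg_le_xx_section:
  assumes "is_section k n S c" "i \<in> {1..n-1}" "j \<in> {1..vdim k n i}"
  shows "deg_le S (of_bool (j = c i)) (xx i j)"
  using deg_le_xx[of S i j] assms by (simp add: is_section_def)

lemma deg_le_vdm:
  assumes S: "is_section k n S c"
  shows "deg_le S (\<Sum>i\<in>{1..n-1}. vdim k n i - 1) (vdm k n xx :: xmonom \<Rightarrow>\<^sub>0 'a::comm_ring_1)"
  unfolding vdm_def
proof (rule deg_le_prod)
  fix i
  assume i: "i \<in> {1..n-1}"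
  then have c: "c i \<in> {1..vdim k n i}"
    using S by (simp add: is_section_def)
  have "deg_le S (of_bool (a = c i \<or> b = c i)) (xx i b - xx i a :: xmonom \<Rightarrow>\<^sub>0 'a)"
    if "a \<in> {1..vdim k n i}" "b \<in> {a<..vdim k n i}" for a b
    by (rule deg_le_diff; rule deg_le_mono, rule deg_le_xx_section[OF S i]) (use that in auto)
  then show "deg_le S (vdim k n i - 1) (\<Prod>a\<in>{1..vdim k n i}. \<Prod>b\<in>{a<..vdim k n i}. xx i b - xx i a :: xmonom \<Rightarrow>\<^sub>0 'a)"
    unfolding sum_increasing_pairs_touching[OF c, symmetric] by (intro deg_le_prod)
qed

text \<open>Each group contributes its exponent times the number of its factors that the selection
  touches; the summand \<open>2 * e3\<close> comes from the selected variables of the rows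
  \<open>k\<close> and \<open>n - k\<close>.\<close>

lemma deg_le_master:
  fixes w q :: "'a::comm_ring_1"
  assumes kn: "0 < k" "2 * k \<le> n" and S: "is_section k n S c"
  shows "deg_le S ((n - 1) * e1 + (\<Sum>i\<in>{1..n-1}. 2 * (vdim k n i - 1)) * e2
      + (\<Sum>i\<in>{1..n-2}. vdim k n i + vdim k n (i + 1) - 1) * e3 + 2 * e3)
    (master k n e1 e2 e3 xx (xc w) (xc q))"
  unfolding master_def
proof (intro deg_le_mult)
  have c: "c i \<in> {1..vdim k n i}" if "i \<in> {1..n-1}" for i
    using S that by (simp add: is_section_def)
  have "deg_le S (\<Sum>i\<in>{1..n-1}. 1) (\<Prod>i\<in>{1..n-1}. \<Prod>j\<in>{1..vdim k n i}. xx i j :: xmonom \<Rightarrow>\<^sub>0 'a)"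
  proof (rule deg_le_prod)
    fix i
    assume i: "i \<in> {1..n-1}"
    have "(\<Sum>j\<in>{1..vdim k n i}. of_bool (j = c i)) = (1::nat)"
      using c[OF i] by (simp add: of_bool_def)
    then show "deg_le S 1 (\<Prod>j\<in>{1..vdim k n i}. xx i j :: xmonom \<Rightarrow>\<^sub>0 'a)"
      using deg_le_prod[OF deg_le_xx_section[OF S i], of "{1..vdim k n i}" "\<lambda>j. j"] by simp
  qed
  from deg_le_power[OF this, of e1]
  show "deg_le S ((n - 1) * e1) ((\<Prod>i\<in>{1..n-1}. \<Prod>j\<in>{1..vdim k n i}. xx i j :: xmonom \<Rightarrow>\<^sub>0 'a) ^ e1)"
    by simp
  show "deg_le S ((\<Sum>i\<in>{1..n-1}. 2 * (vdim k n i - 1)) * e2)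
     (\<Prod>i\<in>{1..n-1}. \<Prod>a\<in>{1..vdim k n i}. \<Prod>b\<in>{1..vdim k n i} - {a}. qpoch (xc q) (xx i a) (xx i b) e2)"
    unfolding sum_distrib_right
  proof (rule deg_le_prod)
    fix i
    assume i: "i \<in> {1..n-1}"
    have "deg_le S (of_bool (a = c i \<or> b = c i) * e2) (qpoch (xc q) (xx i a) (xx i b) e2)"
      if "a \<in> {1..vdim k n i}" "b \<in> {1..vdim k n i} - {a}" for a b
      by (rule deg_le_qpoch; rule deg_le_mono, rule deg_le_xx_section[OF S i]) (use that in auto)
    then have "deg_le S (\<Sum>a\<in>{1..vdim k n i}. \<Sum>b\<in>{1..vdim k n i} - {a}. of_bool (a = c i \<or> b = c i) * e2)
        (\<Prod>a\<in>{1..vdim k n i}. \<Prod>b\<in>{1..vdim k n i} - {a}. qpoch (xc q) (xx i a) (xx i b) e2)"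
      by (intro deg_le_prod)
    then show "deg_le S (2 * (vdim k n i - 1) * e2)
        (\<Prod>a\<in>{1..vdim k n i}. \<Prod>b\<in>{1..vdim k n i} - {a}. qpoch (xc q) (xx i a) (xx i b) e2)"
      unfolding sum_distrib_right[symmetric] using sum_pairs_touching[OF _ c[OF i]] by simp
  qed
  show "deg_le S ((\<Sum>i\<in>{1..n-2}. vdim k n i + vdim k n (i + 1) - 1) * e3)
     (\<Prod>i\<in>{1..n-2}. \<Prod>a\<in>{1..vdim k n i}. \<Prod>b\<in>{1..vdim k n (i+1)}. qpoch (xc q) (xx i a) (xx (i+1) b) e3)"
    unfolding sum_distrib_right
  proof (rule deg_le_prod)
    fix i
    assume "i \<in> {1..n-2}"
    then have i: "i \<in> {1..n-1}" "i + 1 \<in> {1..n-1}"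
      by auto
    have "deg_le S (of_bool (a = c i \<or> b = c (i+1)) * e3) (qpoch (xc q) (xx i a) (xx (i+1) b) e3)"
      if "a \<in> {1..vdim k n i}" "b \<in> {1..vdim k n (i+1)}" for a b
    proof (rule deg_le_qpoch)
      show "deg_le S (of_bool (a = c i \<or> b = c (i+1))) (xx i a :: xmonom \<Rightarrow>\<^sub>0 'a)"
        by (rule deg_le_mono, rule deg_le_xx_section[OF S i(1)]) (use that in auto)
      show "deg_le S (of_bool (a = c i \<or> b = c (i+1))) (xx (i+1) b :: xmonom \<Rightarrow>\<^sub>0 'a)"
        by (rule deg_le_mono, rule deg_le_xx_section[OF S i(2)]) (use that in auto)
    qed
    then have "deg_le S (\<Sum>a\<in>{1..vdim k n i}. \<Sum>b\<in>{1..vdim k n (i+1)}. of_bool (a = c i \<or> b = c (i+1)) * e3)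
        (\<Prod>a\<in>{1..vdim k n i}. \<Prod>b\<in>{1..vdim k n (i+1)}. qpoch (xc q) (xx i a) (xx (i+1) b) e3)"
      by (intro deg_le_prod)
    then show "deg_le S ((vdim k n i + vdim k n (i + 1) - 1) * e3)
        (\<Prod>a\<in>{1..vdim k n i}. \<Prod>b\<in>{1..vdim k n (i+1)}. qpoch (xc q) (xx i a) (xx (i+1) b) e3)"
      unfolding sum_distrib_right[symmetric] using sum_product_touching[OF _ c[OF i(1)] _ c[OF i(2)]] by simp
  qed
  have end_row: "deg_le S (of_bool (a = c i)) (xx i a :: xmonom \<Rightarrow>\<^sub>0 'a)" "(\<Sum>a\<in>{1..k}. of_bool (a = c i)) = (1::nat)"
    if "i = k \<or> i = n - k" "a \<in> {1..k}" for i a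
  proof -
    have i: "i \<in> {1..n-1}" "vdim k n i = k"
      using that kn by (auto simp: vdim_def)
    then show "deg_le S (of_bool (a = c i)) (xx i a :: xmonom \<Rightarrow>\<^sub>0 'a)"
      using deg_le_xx_section[OF S, of i a] that by simp
    show "(\<Sum>a\<in>{1..k}. of_bool (a = c i)) = (1::nat)"
      using c[OF i(1)] i(2) by (simp add: of_bool_def)
  qed
  have "deg_le S (\<Sum>a\<in>{1..k}. of_bool (a = c k) * e3 + of_bool (a = c (n-k)) * e3)
      (\<Prod>a\<in>{1..k}. qpoch (xc q) (xc w) (xx k a) e3 * qpoch (xc q) 1 (xx (n-k) a) e3)"
    by (intro deg_le_prod deg_le_mult deg_le_qpoch deg_le_xc deg_le_one end_row) auto
  moreover have "(\<Sum>a\<in>{1..k}. of_bool (a = c k) * e3 + of_bool (a = c (n-k)) * e3) = 2 * e3"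
    unfolding sum.distrib sum_distrib_right[symmetric] using end_row(2)[of k 1] end_row(2)[of "n-k" 1] kn by simp
  ultimately show "deg_le S (2 * e3)
      (\<Prod>a\<in>{1..k}. qpoch (xc q) (xc w) (xx k a) e3 * qpoch (xc q) 1 (xx (n-k) a) e3)"
    by simp
qed

lemma vdim_pos: "0 < k \<Longrightarrow> 2 * k \<le> n \<Longrightarrow> i \<in> {1..n-1} \<Longrightarrow> 1 \<le> vdim k n i"
  by (auto simp: vdim_def)

text \<open>The relations \<open>e\<close> are those of the exponents of \<open>Phi_bar\<close> for
  \<open>M = p ^ s\<close>. They bring the bound to \<open>(M - 1) * (n - 1)\<close>, plus
  \<open>M\<close> times the bound for \<open>vdm\<close>, plus an excess \<open>e3 < M\<close> that
  does not survive the division by \<open>M\<close> in \<open>deg_le_cartier\<close>.\<close>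

lemma deg_le_vdm_master:
  fixes w q :: "'a::comm_ring_1"
  assumes kn: "0 < k" "2 * k \<le> n" and S: "is_section k n S c"
    and M: "0 < M" and e: "e1 + e3 = M - 1" "2 * e2 + 2 * e3 = M - 1"
  shows "deg_le S ((M - 1) * (n - 1) + M * (\<Sum>i\<in>{1..n-1}. vdim k n i - 1) + e3)
    (vdm k n xx * master k n e1 e2 e3 xx (xc w) (xc q))"
proof -
  define U where "U = n - 1"
  define W where "W = (\<Sum>i\<in>{1..n-1}. vdim k n i - 1)"
  have U: "U = Suc (n - 2)"
    using kn by (simp add: U_def)
  have v1: "vdim k n 1 = 1" "vdim k n U = 1"
    using kn by (auto simp: vdim_def U_def)
  have "vdim k n i + vdim k n (i + 1) - 1 = (vdim k n i - 1) + (vdim k n (i + 1) - 1) + 1"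
    if "i \<in> {1..n-2}" for i
  proof -
    have "1 \<le> vdim k n i" "1 \<le> vdim k n (i + 1)"
      using that by (auto intro!: vdim_pos[OF kn] simp del: One_nat_def)
    then show ?thesis
      by simp
  qed
  then have "(\<Sum>i\<in>{1..n-2}. vdim k n i + vdim k n (i + 1) - 1) =
      (\<Sum>i\<in>{1..n-2}. (vdim k n i - 1) + (vdim k n (i + 1) - 1) + 1)"
    by (rule sum.cong[OF refl])
  also have "\<dots> = (\<Sum>i\<in>{1..n-2}. vdim k n i - 1) + (\<Sum>i\<in>{1..n-2}. vdim k n (Suc i) - 1) + (n - 2)"
    unfolding sum.distrib by simp
  \<comment> \<open>The row left out, \<open>n - 1\<close>, has a single variable and contributes
    zero; so does row 1, missing from the shifted sum below.\<close>
  also have "(\<Sum>i\<in>{1..n-2}. vdim k n i - 1) = W"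
    using v1(2) unfolding W_def U_def[symmetric] U by simp
  also have "(\<Sum>i\<in>{1..n-2}. vdim k n (Suc i) - 1) = W"
  proof -
    have "W = (vdim k n 1 - 1) + (\<Sum>i\<in>{Suc 1..Suc (n - 2)}. vdim k n i - 1)"
      unfolding W_def U_def[symmetric] U by (rule sum.atLeast_Suc_atMost) simp
    then show ?thesis
      unfolding sum.shift_bounds_cl_Suc_ivl v1 by simp
  qed
  finally have cross: "(\<Sum>i\<in>{1..n-2}. vdim k n i + vdim k n (i + 1) - 1) = 2 * W + (n - 2)"
    by simp
  have row: "(\<Sum>i\<in>{1..n-1}. 2 * (vdim k n i - 1)) = 2 * W"
    by (simp add: W_def sum_distrib_left)
  have "deg_le S (W + (U * e1 + 2 * W * e2 + (2 * W + (n - 2)) * e3 + 2 * e3))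
      (vdm k n xx * master k n e1 e2 e3 xx (xc w) (xc q))"
    using deg_le_mult[OF deg_le_vdm[OF S] deg_le_master[OF kn S]]
    unfolding cross row unfolding W_def[symmetric] unfolding U_def[symmetric] .
  moreover have "W + (U * e1 + 2 * W * e2 + (2 * W + (n - 2)) * e3 + 2 * e3) \<le> (M - 1) * U + M * W + e3"
  proof -
    \<comment> \<open>Of the final \<open>2 * e3\<close>, one \<open>e3\<close> completes
      \<open>(n - 2) * e3\<close> to \<open>U * e3\<close>, and the other is the excess.\<close>
    have "W + (U * e1 + 2 * W * e2 + (2 * W + (n - 2)) * e3 + 2 * e3) =
        U * (e1 + e3) + W * (2 * e2 + 2 * e3) + W + e3"
      unfolding U by (simp add: distrib_left distrib_right mult.commute[of "n - 2"] mult_ac)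
    also have "\<dots> = (M - 1) * U + W * (M - 1) + W + e3"
      unfolding e by simp
    finally show ?thesis
      using M by (cases M) simp_all
  qed
  ultimately show ?thesis
    unfolding U_def W_def by (rule deg_le_mono)
qed

section \<open>Alternating polynomials\<close>

definition perm_vars :: "('v \<Rightarrow> 'v) \<Rightarrow> ('v \<Rightarrow>\<^sub>0 nat) \<Rightarrow> 'v \<Rightarrow>\<^sub>0 nat" where
  "perm_vars \<tau> u = Poly_Mapping.map_key \<tau> u"

lemma lookup_perm_vars: "inj \<tau> \<Longrightarrow> lookup (perm_vars \<tau> u) v = lookup u (\<tau> v)"
  by (simp add: perm_vars_def map_key.rep_eq)

definition alternating :: "nat \<Rightarrow> nat \<Rightarrow> (xmonom \<Rightarrow>\<^sub>0 'a::comm_ring_1) \<Rightarrow> bool" where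
  "alternating k n P \<longleftrightarrow> (\<forall>i\<in>{1..n-1}. \<forall>a\<in>{1..vdim k n i}. \<forall>b\<in>{1..vdim k n i}. a \<noteq> b \<longrightarrow>
     (\<forall>u. lookup P (perm_vars (transpose (i, a) (i, b)) u) = - lookup P u))"

text \<open>An adjacent transposition permutes the pairs \<open>a < b\<close> other than
  \<open>(j, Suc j)\<close> among themselves and reverses only that one.\<close>

lemma prod_increasing_pairs_transpose:
  fixes x :: "nat \<Rightarrow> 'a::comm_ring_1"
  assumes "1 \<le> j" "Suc j \<le> v"
  shows "(\<Prod>a\<in>{1..v}. \<Prod>b\<in>{a<..v}. x (transpose j (Suc j) b) - x (transpose j (Suc j) a)) =
    - (\<Prod>a\<in>{1..v}. \<Prod>b\<in>{a<..v}. x b - x a)"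
proof -
  define R where "R = (SIGMA a:{1..v}. {a<..v}) - {(j, Suc j)}"
  define \<sigma> where "\<sigma> = transpose j (Suc j)"
  have split: "(\<Prod>a\<in>{1..v}. \<Prod>b\<in>{a<..v}. y b - y a) = (y (Suc j) - y j) * (\<Prod>(a,b)\<in>R. y b - y a)" for y :: "nat \<Rightarrow> 'a"
  proof -
    have "(\<Prod>a\<in>{1..v}. \<Prod>b\<in>{a<..v}. y b - y a) = (\<Prod>(a,b)\<in>(SIGMA a:{1..v}. {a<..v}). y b - y a)"
      by (rule prod.Sigma) auto
    also have "\<dots> = (case (j, Suc j) of (a, b) \<Rightarrow> y b - y a) * (\<Prod>(a,b)\<in>R. y b - y a)"
      unfolding R_def using assms by (intro prod.remove) auto
    finally show ?thesis
      by simp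
  qed
  have "(\<Prod>(a,b)\<in>R. x (\<sigma> b) - x (\<sigma> a)) = (\<Prod>(a,b)\<in>R. x b - x a)"
  proof (rule prod.reindex_bij_witness[where i = "map_prod \<sigma> \<sigma>" and j = "map_prod \<sigma> \<sigma>"])
    have inv: "\<sigma> (\<sigma> a) = a" for a
      by (simp add: \<sigma>_def)
    show "map_prod \<sigma> \<sigma> (map_prod \<sigma> \<sigma> c) = c" for c
      by (cases c) (simp add: inv)
    show "map_prod \<sigma> \<sigma> c \<in> R" if "c \<in> R" for c
      using that assms by (cases c) (auto simp: R_def \<sigma>_def transpose_def split: if_splits)
    then show "map_prod \<sigma> \<sigma> c \<in> R" if "c \<in> R" for c
      using that .
  qed (auto simp: \<sigma>_def)
  moreover have "\<sigma> j = Suc j" "\<sigma> (Suc j) = j"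
    by (simp_all add: \<sigma>_def)
  ultimately have "(\<Prod>a\<in>{1..v}. \<Prod>b\<in>{a<..v}. x (\<sigma> b) - x (\<sigma> a)) = (x j - x (Suc j)) * (\<Prod>(a,b)\<in>R. x b - x a)"
    using split[of "\<lambda>a. x (\<sigma> a)"] by simp
  also have "\<dots> = - ((x (Suc j) - x j) * (\<Prod>(a,b)\<in>R. x b - x a))"
    by (simp only: minus_mult_left minus_diff_eq)
  also note split[of x, symmetric]
  finally show ?thesis
    by (simp only: \<sigma>_def)
qed

lemma vdm_transpose:
  assumes i: "i \<in> {1..n-1}" and j: "1 \<le> j" "Suc j \<le> vdim k n i"
  shows "vdm k n (\<lambda>i' a. X i' (if i' = i then transpose j (Suc j) a else a)) = - vdm k n X"
proof -
  have "vdm k n X = (\<Prod>a\<in>{1..vdim k n i}. \<Prod>b\<in>{a<..vdim k n i}. X i b - X i a) *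
      (\<Prod>i'\<in>{1..n-1} - {i}. \<Prod>a\<in>{1..vdim k n i'}. \<Prod>b\<in>{a<..vdim k n i'}. X i' b - X i' a)" for X :: "nat \<Rightarrow> nat \<Rightarrow> 'a"
    unfolding vdm_def using i by (intro prod.remove) auto
  note split = this
  show ?thesis
    unfolding split[of X] split[of "\<lambda>i' a. X i' (if i' = i then transpose j (Suc j) a else a)"]
    using prod_increasing_pairs_transpose[OF j, of "X i"] by simp
qed

lemma transpose_row: "transpose (i, a) (i, b) (i', j) = (i', if i' = i then transpose a b j else j)"
  by (auto simp: transpose_def)

lemma inj_transpose: "inj (transpose a b)"
  by (rule bij_is_inj, rule bij_transpose)

lemma transpose_conjugate:
  assumes "y \<noteq> x" "y \<noteq> z" "x \<noteq> z"
  shows "transpose x z v = transpose x y (transpose y z (transpose x y v))"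
  using assms by (simp add: transpose_def)

text \<open>Adjacent swaps suffice: by \<open>transpose_conjugate\<close> a longer swap is a product
  of three shorter ones, which change the sign three times.\<close>

lemma alternatingI:
  assumes adj: "\<And>i j u. i \<in> {1..n-1} \<Longrightarrow> 1 \<le> j \<Longrightarrow> Suc j \<le> vdim k n i \<Longrightarrow>
    lookup P (perm_vars (transpose (i, j) (i, Suc j)) u) = - lookup P u"
  shows "alternating k n P"
  unfolding alternating_def
proof (intro ballI impI allI)
  fix i a b u
  assume i: "i \<in> {1..n-1}" and ab: "a \<in> {1..vdim k n i}" "b \<in> {1..vdim k n i}" "a \<noteq> b"
  have up: "lookup P (perm_vars (transpose (i, a) (i, a + Suc d)) u) = - lookup P u"
    if "1 \<le> a" "a + Suc d \<le> vdim k n i" for a d u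
    using that
  proof (induction d arbitrary: u)
    case 0
    then show ?case using adj[OF i, of a u] by simp
  next
    case (Suc d)
    let ?t = "transpose (i, a) (i, a + Suc d)" and ?s = "transpose (i, a + Suc d) (i, Suc (a + Suc d))"
    have "perm_vars (transpose (i, a) (i, a + Suc (Suc d))) u = perm_vars ?t (perm_vars ?s (perm_vars ?t u))"
      by (rule poly_mapping_eqI)
        (simp only: lookup_perm_vars[OF inj_transpose], subst transpose_conjugate[of "(i, a + Suc d)"], simp_all)
    then show ?case
      using Suc.IH Suc.prems adj[OF i, of "a + Suc d"] by simp
  qed
  show "lookup P (perm_vars (transpose (i, a) (i, b)) u) = - lookup P u"
  proof (cases "a < b")
    case True
    with up[of a "b - a - 1" u] ab show ?thesis by simp
  next
    case False
    with up[of b "a - b - 1" u] ab show ?thesis by (simp add: transpose_commute)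
  qed
qed

text \<open>Renaming the variables by an adjacent swap in a row is a ring homomorphism; it negates
  the Vandermonde factor and fixes the master factor.\<close>

lemma alternating_vdm_master:
  fixes w q :: "'a::comm_ring_1"
  assumes kn: "0 < k" "2 * k \<le> n"
  shows "alternating k n (vdm k n xx * master k n e1 e2 e3 xx (xc w) (xc q))"
proof (rule alternatingI)
  fix i j u
  assume ij: "i \<in> {1..n-1}" "1 \<le> j" "Suc j \<le> vdim k n i"
  define \<tau> where "\<tau> = transpose (i, j) (i, Suc j)"
  define \<sigma> where "\<sigma> = (\<lambda>i' a. if i' = i then transpose j (Suc j) a else a)"
  define P where "P = vdm k n xx * master k n e1 e2 e3 xx (xc w) (xc q)"
  have \<tau>: "inj \<tau>"
    by (simp add: \<tau>_def inj_transpose)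
  have hom: "cring_hom (mono_hom (perm_vars \<tau>) (\<lambda>x. x) :: (xmonom \<Rightarrow>\<^sub>0 'a) \<Rightarrow> _)"
    by (rule cring_hom_mono_hom[OF cring_hom_id])
      (auto intro!: poly_mapping_eqI simp: lookup_perm_vars \<tau> lookup_add)
  interpret H: cring_hom "mono_hom (perm_vars \<tau>) (\<lambda>x. x) :: (xmonom \<Rightarrow>\<^sub>0 'a) \<Rightarrow> _"
    by (rule hom)
  have Hx: "mono_hom (perm_vars \<tau>) (\<lambda>x. x) (xx i' a) = (xx i' (\<sigma> i' a) :: xmonom \<Rightarrow>\<^sub>0 'a)" for i' a
  proof -
    have "x = \<tau> v \<longleftrightarrow> \<tau> x = v" for x v
      unfolding \<tau>_def by (metis transpose_involutory)
    then have "perm_vars \<tau> (Poly_Mapping.single (i', a) 1) = Poly_Mapping.single (\<tau> (i', a)) 1"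
      by (intro poly_mapping_eqI) (simp add: lookup_perm_vars \<tau> lookup_single)
    then show ?thesis
      by (simp add: xx_def mono_hom_single \<tau>_def transpose_row \<sigma>_def)
  qed
  have Hc: "mono_hom (perm_vars \<tau>) (\<lambda>x. x) (xc c) = (xc c :: xmonom \<Rightarrow>\<^sub>0 'a)" for c
  proof -
    have "perm_vars \<tau> 0 = 0"
      by (rule poly_mapping_eqI) (simp add: lookup_perm_vars \<tau>)
    then show ?thesis
      by (simp add: xc_def mono_hom_single)
  qed
  have "bij_betw (\<sigma> i') {1..vdim k n i'} {1..vdim k n i'}" for i'
    using ij by (intro bij_betw_byWitness[where f' = "\<sigma> i'"]) (auto simp: \<sigma>_def transpose_def)
  then have "mono_hom (perm_vars \<tau>) (\<lambda>x. x) P = - P"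
    unfolding P_def H.hom_mult H.hom_vdm H.hom_master Hx Hc
    by (subst master_permute[OF kn]) (simp_all add: \<sigma>_def vdm_transpose[OF ij])
  moreover have "inj (perm_vars \<tau>)"
  proof (rule injI)
    fix u u' :: xmonom
    assume *: "perm_vars \<tau> u = perm_vars \<tau> u'"
    have "lookup u v = lookup u' v" for v
      using arg_cong[OF *, of "\<lambda>m. lookup m (\<tau> v)"] by (simp add: lookup_perm_vars \<tau>) (simp add: \<tau>_def)
    then show "u = u'"
      by (rule poly_mapping_eqI)
  qed
  ultimately have "- lookup P (perm_vars \<tau> u) = lookup P u"
    using lookup_mono_hom[OF cring_hom_id, of "perm_vars \<tau>" P u] by simp
  then show "lookup P (perm_vars (transpose (i, j) (i, Suc j)) u) = - lookup P u"
    by (metis add.inverse_inverse \<tau>_def)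
qed

section \<open>Row monomials and the staircase\<close>

text \<open>The common form of all exponents needed: the target \<open>j * p ^ s - 1\<close>, the
  staircase \<open>j - 1\<close> (its case \<open>s = 0\<close>), and the constant shift
  \<open>M - 1\<close> of the Cartier transform.\<close>

definition row_monom :: "nat \<Rightarrow> nat \<Rightarrow> (nat \<Rightarrow> nat \<Rightarrow> nat) \<Rightarrow> xmonom" where
  "row_monom k n f = (\<Sum>i\<in>{1..n-1}. \<Sum>j\<in>{1..vdim k n i}. Poly_Mapping.single (i, j) (f i j))"

lemma lookup_row_monom:
  "lookup (row_monom k n f) (a, b) = (if a \<in> {1..n-1} \<and> b \<in> {1..vdim k n a} then f a b else 0)"
proof -
  have "lookup (row_monom k n f) (a, b) =
      (\<Sum>i\<in>{1..n-1}. \<Sum>j\<in>{1..vdim k n i}. if i = a then if j = b then f i j else 0 else 0)"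
    by (auto simp: row_monom_def lookup_sum lookup_single when_def intro!: sum.cong)
  also have "\<dots> = (\<Sum>i\<in>{1..n-1}. if i = a then \<Sum>j\<in>{1..vdim k n i}. if j = b then f i j else 0 else 0)"
    by (rule sum.cong) auto
  finally show ?thesis
    by simp
qed

text \<open>The shift is constant on the rows, hence fixed by every swap inside a row.\<close>

lemma cartier_alternating:
  assumes "alternating k n P" "0 < M"
  shows "alternating k n (cartier M (row_monom k n (\<lambda>_ _. e)) P)"
  unfolding alternating_def
proof (intro ballI impI allI)
  fix i a b u
  assume ab: "i \<in> {1..n-1}" "a \<in> {1..vdim k n i}" "b \<in> {1..vdim k n i}" "a \<noteq> b"
  define c where "c = row_monom k n (\<lambda>_ _. e)"
  define \<tau> where "\<tau> = transpose (i, a) (i, b)"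
  have \<tau>: "inj \<tau>"
    by (simp add: \<tau>_def inj_transpose)
  have "lookup c (\<tau> v) = lookup c v" for v
    unfolding \<tau>_def c_def using ab by (cases v) (auto simp: transpose_row lookup_row_monom transpose_def)
  then have "scale M (perm_vars \<tau> u) + c = perm_vars \<tau> (scale M u + c)"
    by (intro poly_mapping_eqI) (simp add: lookup_add lookup_perm_vars \<tau>)
  then show "lookup (cartier M c P) (perm_vars (transpose (i, a) (i, b)) u) = - lookup (cartier M c P) u"
    using assms(1) ab unfolding lookup_cartier[OF assms(2)] alternating_def by (metis \<tau>_def)
qed

text \<open>An alternating polynomial whose degree in one variable per row never exceeds that of the
  Vandermonde product is supported on the row permutations of the staircase monomial.\<close>

lemma alternating_staircase_zero:
  fixes P :: "xmonom \<Rightarrow>\<^sub>0 complex"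
  assumes alt: "alternating k n P"
    and deg: "\<And>S c. is_section k n S c \<Longrightarrow> deg_le S (\<Sum>i\<in>{1..n-1}. vdim k n i - 1) P"
    and stair: "lookup P (row_monom k n (\<lambda>_ j. j - 1)) = 0"
    and pos: "\<And>i. i \<in> {1..n-1} \<Longrightarrow> 1 \<le> vdim k n i"
  shows "P = 0"
proof (rule poly_mapping_eqI)
  define V where "V = (SIGMA i:{1..n-1}. {1..vdim k n i})"
  define \<delta> where "\<delta> = row_monom k n (\<lambda>_ j. j - 1)"
  have finV: "finite V"
    by (simp add: V_def)
  fix u
  have "lookup P u = 0"
  \<comment> \<open>Induction on the number of positions where \<open>u\<close> differs from the
    staircase: a swap that corrects one of them only changes the sign of the coefficient.\<close>
  proof (induction "card {v \<in> V. lookup u v \<noteq> lookup \<delta> v}" arbitrary: u rule: less_induct)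
    case less
    show ?case
    proof (rule ccontr)
      assume nz: "lookup P u \<noteq> 0"
      \<comment> \<open>If two exponents of a row coincide, swapping these variables fixes
        \<open>u\<close>, and the coefficient equals its own negative.\<close>
      have inj: "inj_on (\<lambda>j. lookup u (i, j)) {1..vdim k n i}" if i: "i \<in> {1..n-1}" for i
      proof (rule inj_onI, rule ccontr)
        fix a b
        assume ab: "a \<in> {1..vdim k n i}" "b \<in> {1..vdim k n i}" "lookup u (i, a) = lookup u (i, b)" "a \<noteq> b"
        have "perm_vars (transpose (i, a) (i, b)) u = u"
          using ab by (intro poly_mapping_eqI) (auto simp: lookup_perm_vars inj_transpose transpose_def)
        then have "lookup P u = - lookup P u"
          using alt i ab unfolding alternating_def by metis
        with nz show False
          by simp
      qed
      have "\<exists>a\<in>{1..vdim k n i}. \<forall>j\<in>{1..vdim k n i}. lookup u (i, j) \<le> lookup u (i, a)" if i: "i \<in> {1..n-1}" for i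
      proof -
        let ?f = "\<lambda>j. lookup u (i, j)"
        have "?f ` {1..vdim k n i} \<noteq> {}"
          using pos[OF i] by simp
        then have "Max (?f ` {1..vdim k n i}) \<in> ?f ` {1..vdim k n i}"
          by (intro Max_in) auto
        then obtain a where "a \<in> {1..vdim k n i}" "?f a = Max (?f ` {1..vdim k n i})"
          by (metis (no_types, lifting) imageE)
        then show ?thesis
          by (intro bexI[of _ a]) auto
      qed
      then obtain c where c: "\<And>i. i \<in> {1..n-1} \<Longrightarrow> c i \<in> {1..vdim k n i}"
        and max: "\<And>i j. i \<in> {1..n-1} \<Longrightarrow> j \<in> {1..vdim k n i} \<Longrightarrow> lookup u (i, j) \<le> lookup u (i, c i)"
        by metis
      \<comment> \<open>Distinct natural numbers in a row force a maximum of at least the row length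
        minus one.\<close>
      have big: "vdim k n i - 1 \<le> lookup u (i, c i)" if i: "i \<in> {1..n-1}" for i
      proof -
        have "(\<lambda>j. lookup u (i, j)) ` {1..vdim k n i} \<subseteq> {..lookup u (i, c i)}"
          using max[OF i] by auto
        then have "card ((\<lambda>j. lookup u (i, j)) ` {1..vdim k n i}) \<le> card {..lookup u (i, c i)}"
          by (intro card_mono) auto
        then show ?thesis
          using card_image[OF inj[OF i]] by simp
      qed
      define S where "S = (\<lambda>i. (i, c i)) ` {1..n-1}"
      \<comment> \<open>The selection consists of the row maxima, enlarged by \<open>v\<close> if
        \<open>v\<close> lies outside the rows. Against the lower bound \<open>big\<close> this
        leaves no room: every maximum is exactly \<open>vdim k n i - 1\<close>, and no outside
        variable occurs.\<close>
      have bound: "(\<Sum>i\<in>{1..n-1}. lookup u (i, c i)) + (if v \<in> V then 0 else lookup u v) \<le>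
          (\<Sum>i\<in>{1..n-1}. vdim k n i - 1)" for v
      proof -
        define S' where "S' = (if v \<in> V then S else insert v S)"
        have SV: "S \<subseteq> V"
          using c by (auto simp: S_def V_def)
        have "finite S"
          by (simp add: S_def)
        have "is_section k n S' c"
          using c \<open>finite S\<close> by (auto simp: is_section_def S'_def S_def V_def)
        from deg[OF this] nz have "weight S' u \<le> (\<Sum>i\<in>{1..n-1}. vdim k n i - 1)"
          by (simp add: deg_le_def)
        moreover have "weight S' u = weight S u + (if v \<in> V then 0 else lookup u v)"
        proof (cases "v \<in> V")
          case False
          with SV have "v \<notin> S"
            by blast
          with False \<open>finite S\<close> show ?thesis
            by (simp add: S'_def weight_def)
        qed (simp add: S'_def)
        moreover have "weight S u = (\<Sum>i\<in>{1..n-1}. lookup u (i, c i))"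
          unfolding weight_def S_def by (subst sum.reindex) (auto simp: inj_on_def)
        ultimately show ?thesis
          by simp
      qed
      have sum_ge: "(\<Sum>i\<in>{1..n-1}. vdim k n i - 1) \<le> (\<Sum>i\<in>{1..n-1}. lookup u (i, c i))"
        by (intro sum_mono big)
      have out: "lookup u v = 0" if "v \<notin> V" for v
        using bound[of v] sum_ge that by simp
      have eq: "lookup u (i, c i) = vdim k n i - 1" if i: "i \<in> {1..n-1}" for i
      proof (rule ccontr)
        assume "lookup u (i, c i) \<noteq> vdim k n i - 1"
        with big[OF i] have "vdim k n i - 1 < lookup u (i, c i)"
          by simp
        with i big have "(\<Sum>i\<in>{1..n-1}. vdim k n i - 1) < (\<Sum>i\<in>{1..n-1}. lookup u (i, c i))"
          by (intro sum_strict_mono_ex1) auto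
        \<comment> \<open>Any index would do, as the extra summand is nonnegative.\<close>
        with bound[of "(1, 1)"] show False
          by simp
      qed
      show False
      proof (cases "u = \<delta>")
        case True
        with stair nz show False
          by (simp add: \<delta>_def)
      next
        case False
        then obtain i j where v: "lookup u (i, j) \<noteq> lookup \<delta> (i, j)"
          by (metis poly_mapping_eqI surj_pair)
        have V: "(i, j) \<in> V \<longleftrightarrow> i \<in> {1..n-1} \<and> j \<in> {1..vdim k n i}"
          by (simp add: V_def)
        have ij: "i \<in> {1..n-1}" "j \<in> {1..vdim k n i}"
          using v out[of "(i, j)"] unfolding V \<delta>_def lookup_row_monom by presburger+
        then have uij: "lookup u (i, j) \<noteq> j - 1"
          using v by (simp add: \<delta>_def lookup_row_monom)
        \<comment> \<open>The row holds \<open>vdim k n i\<close> distinct exponents below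
          \<open>vdim k n i\<close>, so it is a permutation of the staircase row.\<close>
        have "(\<lambda>j. lookup u (i, j)) ` {1..vdim k n i} = {..<vdim k n i}"
        proof (rule card_subset_eq)
          show "(\<lambda>j. lookup u (i, j)) ` {1..vdim k n i} \<subseteq> {..<vdim k n i}"
          proof (intro image_subsetI)
            fix j assume "j \<in> {1..vdim k n i}"
            with max[OF ij(1)] eq[OF ij(1)] pos[OF ij(1)] show "lookup u (i, j) \<in> {..<vdim k n i}"
              by (fastforce dest: le_imp_less_Suc)
          qed
        qed (use card_image[OF inj[OF ij(1)]] in simp_all)
        moreover have "j - 1 \<in> {..<vdim k n i}"
          using ij by auto
        ultimately obtain a where a: "a \<in> {1..vdim k n i}" "lookup u (i, a) = j - 1"
          by (metis (no_types, lifting) imageE)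
        then have "a \<noteq> j"
          using uij by auto
        \<comment> \<open>The swap puts the exponent \<open>j - 1\<close> where it belongs. Position
          \<open>a\<close>, which held it, was wrong before, so the set of wrong positions strictly
          shrinks.\<close>
        define u' where "u' = perm_vars (transpose (i, a) (i, j)) u"
        have u': "lookup u' w = (if w = (i, j) then j - 1 else if w = (i, a) then lookup u (i, j) else lookup u w)" for w
          using \<open>a \<noteq> j\<close> a by (auto simp: u'_def lookup_perm_vars inj_transpose transpose_def)
        have \<delta>ij: "lookup \<delta> (i, j) = j - 1" "lookup \<delta> (i, a) = a - 1"
          using ij a by (auto simp: \<delta>_def lookup_row_monom)
        have "a - 1 \<noteq> j - 1"
          using a ij \<open>a \<noteq> j\<close> by auto
        then have "{v \<in> V. lookup u' v \<noteq> lookup \<delta> v} \<subset> {v \<in> V. lookup u v \<noteq> lookup \<delta> v}"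
          using ij uij a \<delta>ij \<open>a \<noteq> j\<close> by (auto simp: u' V_def psubset_eq set_eq_iff)
        then have "card {v \<in> V. lookup u' v \<noteq> lookup \<delta> v} < card {v \<in> V. lookup u v \<noteq> lookup \<delta> v}"
          using finV by (intro psubset_card_mono) auto
        then have "lookup P u' = 0"
          by (rule less)
        moreover have "lookup P u' = - lookup P u"
          using alt ij a \<open>a \<noteq> j\<close> unfolding alternating_def u'_def by blast
        ultimately show False
          using nz by simp
      qed
    qed
  qed
  then show "lookup P u = lookup 0 u"
    by simp
qed

section \<open>Factorization of coefficients at a root of unity\<close>

lemma lookup_xc_mult: "lookup (xc c * P) m = c * lookup P m"
proof (induction P rule: poly_mapping_induct_single)
  case (single k d)
  then show ?case
    by (simp add: xc_def mult_single lookup_single when_def)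
qed (simp add: distrib_left lookup_add)

lemma xx_power: "xx i j ^ M = Poly_Mapping.single (Poly_Mapping.single (i, j) M) 1"
  by (induction M) (simp_all add: xx_def mult_single flip: single_add)

lemma weight_section:
  assumes "is_section k n S c"
  shows "(n - 1) * e \<le> weight S (row_monom k n (\<lambda>_ _. e))"
proof -
  have c: "c i \<in> {1..vdim k n i}" "(i, c i) \<in> S" if "i \<in> {1..n-1}" for i
    using assms that unfolding is_section_def by blast+
  have "(n - 1) * e = (\<Sum>i\<in>{1..n-1}. lookup (row_monom k n (\<lambda>_ _. e)) (i, c i))"
    using c(1) by (simp add: lookup_row_monom del: One_nat_def)
  also have "\<dots> = (\<Sum>v\<in>(\<lambda>i. (i, c i)) ` {1..n-1}. lookup (row_monom k n (\<lambda>_ _. e)) v)"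
    by (subst sum.reindex) (auto simp: inj_on_def)
  also have "\<dots> \<le> weight S (row_monom k n (\<lambda>_ _. e))"
    unfolding weight_def using assms c(2) by (intro sum_mono2) (auto simp: is_section_def)
  finally show ?thesis .
qed

text \<open>The shift takes \<open>(M - 1) * (n - 1)\<close> off the degree in the selection, and
  the excess \<open>e3 < M\<close> is lost on division by \<open>M\<close>.\<close>

lemma deg_le_cartier:
  assumes S: "is_section k n S c" and M: "e3 < M"
    and P: "deg_le S ((M - 1) * (n - 1) + M * W + e3) P"
  shows "deg_le S W (cartier M (row_monom k n (\<lambda>_ _. M - 1)) P)"
  unfolding deg_le_def
proof (intro allI impI)
  fix u
  assume "lookup (cartier M (row_monom k n (\<lambda>_ _. M - 1)) P) u \<noteq> 0"
  with P M have "weight S (scale M u + row_monom k n (\<lambda>_ _. M - 1)) \<le> (M - 1) * (n - 1) + M * W + e3"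
    by (simp add: deg_le_def lookup_cartier)
  moreover have "weight S (scale M u) = M * weight S u"
    by (simp add: weight_def sum_distrib_left)
  ultimately have "M * weight S u \<le> M * W + e3"
    using weight_section[OF S, of "M - 1"] by (simp add: weight_add mult.commute)
  then have "M * weight S u < M * (W + 1)"
    using M by simp
  then have "weight S u < W + 1"
    by (simp only: mult_less_cancel1)
  then show "weight S u \<le> W"
    by simp
qed

lemma alternating_vdm:
  assumes "0 < k" "2 * k \<le> n"
  shows "alternating k n (vdm k n xx)"
  using alternating_vdm_master[OF assms, of 0 0 0 0 0] by (simp add: master_def qpoch_def)

lemma alternating_lin_comb:
  "alternating k n P \<Longrightarrow> alternating k n Q \<Longrightarrow> alternating k n (xc a * P - xc b * Q)"
  by (simp add: alternating_def lookup_minus lookup_xc_mult)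

text \<open>The difference of the two sides is alternating, obeys the degree bound and has staircase
  coefficient zero. Cross-multiplication avoids dividing by a coefficient that might vanish.\<close>

lemma alternating_proportional:
  fixes P Q :: "xmonom \<Rightarrow>\<^sub>0 complex"
  assumes "0 < k" "2 * k \<le> n" "alternating k n P" "alternating k n Q"
    and "\<And>S c. is_section k n S c \<Longrightarrow> deg_le S (\<Sum>i\<in>{1..n-1}. vdim k n i - 1) P"
    and "\<And>S c. is_section k n S c \<Longrightarrow> deg_le S (\<Sum>i\<in>{1..n-1}. vdim k n i - 1) Q"
  shows "xc (lookup Q (row_monom k n (\<lambda>_ j. j - 1))) * P = xc (lookup P (row_monom k n (\<lambda>_ j. j - 1))) * Q"
proof -
  define R where "R = xc (lookup Q (row_monom k n (\<lambda>_ j. j - 1))) * P - xc (lookup P (row_monom k n (\<lambda>_ j. j - 1))) * Q"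
  have "R = 0"
  proof (rule alternating_staircase_zero)
    show "alternating k n R"
      unfolding R_def by (intro alternating_lin_comb assms)
    show "lookup R (row_monom k n (\<lambda>_ j. j - 1)) = 0"
      by (simp add: R_def lookup_minus lookup_xc_mult)
    show "deg_le S (\<Sum>i\<in>{1..n-1}. vdim k n i - 1) R" if "is_section k n S c" for S c
      unfolding R_def
      using deg_le_mult[OF deg_le_xc[of S 0] assms(5)[OF that]] deg_le_mult[OF deg_le_xc[of S 0] assms(6)[OF that]]
      by (intro deg_le_diff) simp_all
  qed (use vdim_pos[OF assms(1,2)] in simp)
  then show ?thesis
    by (simp add: R_def)
qed

text \<open>The relation between \<open>T_(j+a)\<close>, \<open>T_j\<close> and \<open>T_a\<close>
  with free exponents and without signs; \<open>M\<close> and \<open>L\<close> play the roles of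
  \<open>p ^ j\<close> and \<open>p ^ a\<close>. The first factor on the left is the staircase
  coefficient of \<open>vdm\<close>, kept symbolic.\<close>

lemma coeff_master_root_of_unity:
  fixes w \<zeta> :: complex
  assumes kn: "0 < k" "2 * k \<le> n" and \<zeta>: "primitive_root_of_unity M \<zeta>"
    and e: "e1 + e3 = M - 1" "2 * e2 + 2 * e3 = M - 1" and L: "0 < L"
  shows "lookup (vdm k n xx) (row_monom k n (\<lambda>_ j. j - 1)) *
      lookup (vdm k n xx * master k n (M * e1' + e1) (M * e2' + e2) (M * e3' + e3) xx (xc w) (xc \<zeta>))
        (row_monom k n (\<lambda>_ j. j * (M * L) - 1)) =
    lookup (vdm k n xx * master k n e1 e2 e3 xx (xc w) (xc \<zeta>)) (row_monom k n (\<lambda>_ j. j * M - 1)) *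
    lookup (vdm k n xx * master k n e1' e2' e3' xx (xc (w ^ M)) (xc 1)) (row_monom k n (\<lambda>_ j. j * L - 1))"
proof -
  define A where "A = vdm k n xx * master k n e1 e2 e3 xx (xc w) (xc \<zeta>)"
  define B where "B = master k n e1' e2' e3' xx (xc (w ^ M)) (xc 1)"
  define c where "c = row_monom k n (\<lambda>_ _. M - 1)"
  define A' where "A' = cartier M c A"
  define \<delta> where "\<delta> = row_monom k n (\<lambda>_ j. j - 1)"
  interpret X: cring_hom "xc :: complex \<Rightarrow> _"
    by (rule cring_hom_xc)
  have M: "0 < M" "\<zeta> ^ M = 1"
    using \<zeta> by (auto simp: primitive_root_of_unity_def)
  have "cring_hom (mono_hom (scale M) (\<lambda>x. x) :: (xmonom \<Rightarrow>\<^sub>0 complex) \<Rightarrow> _)"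
    by (rule cring_hom_mono_hom[OF cring_hom_id scale_0 scale_add])
  then interpret F: cring_hom "mono_hom (scale M) (\<lambda>x. x) :: (xmonom \<Rightarrow>\<^sub>0 complex) \<Rightarrow> _" .
  have "mono_hom (scale M) (\<lambda>x. x) (xx i j) = (xx i j ^ M :: xmonom \<Rightarrow>\<^sub>0 complex)" for i j
    unfolding xx_power by (simp add: xx_def mono_hom_single scale_single)
  moreover have "mono_hom (scale M) (\<lambda>x. x) (xc a) = (xc a :: xmonom \<Rightarrow>\<^sub>0 complex)" for a
    by (simp add: xc_def mono_hom_single)
  ultimately have FB: "mono_hom (scale M) (\<lambda>x. x) B = master k n e1' e2' e3' (\<lambda>i a. xx i a ^ M) (xc w ^ M) 1"
    by (simp only: B_def F.hom_master X.hom_power[symmetric] X.hom_1[symmetric])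
  have "xc \<zeta> ^ M = 1"
    using M by (simp add: X.hom_1 flip: X.hom_power)
  then have AB: "vdm k n xx * master k n (M * e1' + e1) (M * e2' + e2) (M * e3' + e3) xx (xc w) (xc \<zeta>) =
      A * mono_hom (scale M) (\<lambda>x. x) B"
    by (simp add: FB A_def mult.assoc master_root_of_unity qpoch_primitive_root[OF cring_hom_xc \<zeta>])
  \<comment> \<open>This identity is the reason for the shift by \<open>M - 1\<close>.
    \<open>L\<close> is general because the staircase itself needs \<open>L = 1\<close>.\<close>
  have target: "row_monom k n (\<lambda>_ j. j * (M * L) - 1) = scale M (row_monom k n (\<lambda>_ j. j * L - 1)) + c"
    if "0 < L" for L
  proof (rule poly_mapping_eqI)
    fix v :: "nat \<times> nat"
    obtain i j where v: "v = (i, j)"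
      by (cases v)
    have "j * (M * L) - 1 = M * (j * L - 1) + (M - 1)" if "1 \<le> j"
    proof -
      have "1 \<le> j * L"
        using that \<open>0 < L\<close> by (cases "j * L") auto
      then obtain d where "j * L = Suc d"
        by (cases "j * L") auto
      with M(1) show ?thesis
        by (simp add: mult.left_commute[of j])
    qed
    then show "lookup (row_monom k n (\<lambda>_ j. j * (M * L) - 1)) v =
        lookup (scale M (row_monom k n (\<lambda>_ j. j * L - 1)) + c) v"
      by (simp add: v c_def lookup_add lookup_row_monom)
  qed
  have "lookup c v < M" for v
    using M by (cases v) (simp add: c_def lookup_row_monom)
  note frob = lookup_mult_frobenius[OF this]
  have "alternating k n A'"
    unfolding A'_def c_def A_def using M by (intro cartier_alternating alternating_vdm_master kn)
  moreover have "deg_le S (\<Sum>i\<in>{1..n-1}. vdim k n i - 1) A'" if "is_section k n S d" for S d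
    unfolding A'_def c_def A_def
    by (rule deg_le_cartier[OF that _ deg_le_vdm_master[OF kn that M(1) e]]) (use e M in simp)
  ultimately have proportional: "xc (lookup (vdm k n xx) \<delta>) * A' = xc (lookup A' \<delta>) * vdm k n xx"
    unfolding \<delta>_def by (intro alternating_proportional kn alternating_vdm deg_le_vdm)
  have A'\<delta>: "lookup A' \<delta> = lookup A (row_monom k n (\<lambda>_ j. j * M - 1))"
    using target[of 1] M by (simp add: A'_def lookup_cartier \<delta>_def)
  have "lookup (vdm k n xx) \<delta> * lookup (A * mono_hom (scale M) (\<lambda>x. x) B) (row_monom k n (\<lambda>_ j. j * (M * L) - 1)) =
      lookup (xc (lookup (vdm k n xx) \<delta>) * A' * B) (row_monom k n (\<lambda>_ j. j * L - 1))"
    unfolding target[OF L] frob by (simp add: A'_def lookup_xc_mult mult.assoc)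
  \<comment> \<open>Replacing the Cartier transform by a multiple of \<open>vdm\<close> restores the
    Vandermonde factor in front of \<open>B\<close>.\<close>
  also have "\<dots> = lookup A' \<delta> * lookup (vdm k n xx * B) (row_monom k n (\<lambda>_ j. j * L - 1))"
    unfolding proportional mult.assoc lookup_xc_mult ..
  finally show ?thesis
    unfolding A'\<delta> AB[symmetric] unfolding A_def B_def \<delta>_def .
qed

section \<open>Arithmetic of the exponents\<close>

lemma pow_minus_1_add: "0 < (p::nat) \<Longrightarrow> p ^ (j + a) - 1 = p ^ j * (p ^ a - 1) + (p ^ j - 1)"
  by (simp add: power_add diff_mult_distrib2)

lemma dvd_pow_minus_1:
  assumes "p = l * m + (1::nat)"
  shows "m dvd p ^ a - 1"
proof (induction a)
  case (Suc a)
  have "p ^ Suc a - 1 = p * (p ^ a - 1) + (p - 1)"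
    using pow_minus_1_add[of p 1 a] assms by simp
  moreover have "m dvd p - 1"
    using assms by simp
  ultimately show ?case
    using Suc by simp
qed simp

text \<open>All divisions are exact, so after clearing the denominators \<open>m\<close> and
  \<open>2 * m\<close> the first two identities are linear in \<open>p ^ a - 1\<close>, and the
  other three are instances of \<open>pow_minus_1_add\<close>.\<close>

lemma exponents:
  fixes r m p l :: nat
  assumes m: "0 < m" "2 * r \<le> m" and p: "odd p" "p = l * m + 1"
  shows "exp_one_minus_om r m p a + exp_om r m p a = p ^ a - 1"
    and "2 * exp_half_one_minus_two_om r m p a + 2 * exp_om r m p a = p ^ a - 1"
    and "exp_one_minus_om r m p (j + a) = p ^ j * exp_one_minus_om r m p a + exp_one_minus_om r m p j"
    and "exp_half_one_minus_two_om r m p (j + a) = p ^ j * exp_half_one_minus_two_om r m p a + exp_half_one_minus_two_om r m p j"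
    and "exp_om r m p (j + a) = p ^ j * exp_om r m p a + exp_om r m p j"
proof -
  have om: "m * exp_om r m p a = (p ^ a - 1) * r" for a
    unfolding exp_om_def by (intro dvd_mult_div_cancel dvd_mult2 dvd_pow_minus_1[OF p(2)])
  have one: "m * exp_one_minus_om r m p a = (p ^ a - 1) * (m - r)" for a
    unfolding exp_one_minus_om_def by (intro dvd_mult_div_cancel dvd_mult2 dvd_pow_minus_1[OF p(2)])
  have half: "2 * m * exp_half_one_minus_two_om r m p a = (p ^ a - 1) * (m - 2 * r)" for a
    unfolding exp_half_one_minus_two_om_def
  proof (intro dvd_mult_div_cancel)
    show "2 * m dvd (p ^ a - 1) * (m - 2 * r)"
    proof (cases "even m")
      case True
      then have "m * 2 dvd (p ^ a - 1) * (m - 2 * r)"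
        by (intro mult_dvd_mono dvd_pow_minus_1[OF p(2)]) simp
      then show ?thesis
        by (simp add: mult.commute)
    next
      case False
      then have "coprime 2 m"
        by simp
      then have "2 * m dvd p ^ a - 1"
        using p by (intro divides_mult dvd_pow_minus_1[OF p(2)]) simp_all
      then show ?thesis
        by simp
    qed
  qed
  have p0: "0 < p"
    using p by simp
  have "m * (exp_one_minus_om r m p a + exp_om r m p a) = m * (p ^ a - 1)"
    using m by (simp add: distrib_left om one flip: add_mult_distrib2)
  then show *: "exp_one_minus_om r m p a + exp_om r m p a = p ^ a - 1"
    using m by simp
  have "m * (2 * exp_half_one_minus_two_om r m p a + 2 * exp_om r m p a) = 2 * m * exp_half_one_minus_two_om r m p a + 2 * (m * exp_om r m p a)"
    by (simp add: algebra_simps)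
  also have "\<dots> = (p ^ a - 1) * ((m - 2 * r) + 2 * r)"
    unfolding half om by (simp add: algebra_simps)
  also have "\<dots> = m * (p ^ a - 1)"
    using m by simp
  finally show "2 * exp_half_one_minus_two_om r m p a + 2 * exp_om r m p a = p ^ a - 1"
    using m by simp
  have "m * exp_one_minus_om r m p (j + a) = m * (p ^ j * exp_one_minus_om r m p a + exp_one_minus_om r m p j)"
    unfolding distrib_left mult.left_commute[of m] one pow_minus_1_add[OF p0] by (simp add: add_mult_distrib mult.assoc)
  then show "exp_one_minus_om r m p (j + a) = p ^ j * exp_one_minus_om r m p a + exp_one_minus_om r m p j"
    using m by simp
  have "2 * m * exp_half_one_minus_two_om r m p (j + a) =
      2 * m * (p ^ j * exp_half_one_minus_two_om r m p a + exp_half_one_minus_two_om r m p j)"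
    unfolding distrib_left mult.left_commute[of "2 * m"] half pow_minus_1_add[OF p0] by (simp add: add_mult_distrib mult.assoc)
  then show "exp_half_one_minus_two_om r m p (j + a) = p ^ j * exp_half_one_minus_two_om r m p a + exp_half_one_minus_two_om r m p j"
    using m by simp
  have "m * exp_om r m p (j + a) = m * (p ^ j * exp_om r m p a + exp_om r m p j)"
    unfolding distrib_left mult.left_commute[of m] om pow_minus_1_add[OF p0] by (simp add: add_mult_distrib mult.assoc)
  then show "exp_om r m p (j + a) = p ^ j * exp_om r m p a + exp_om r m p j"
    using m by simp
qed

section \<open>Complex evaluation and divisibility by the q-bracket\<close>

definition eval_at :: "complex \<Rightarrow> complex \<Rightarrow> int poly poly \<Rightarrow> complex" where
  "eval_at w \<zeta> f = poly (map_poly (\<lambda>c. poly (map_poly of_int c) \<zeta>) f) w"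

lemma cring_hom_poly_of_int: "cring_hom (\<lambda>c. poly (map_poly of_int c) (\<zeta>::complex))"
  by (intro cring_hom_comp[OF cring_hom_poly] cring_hom.map_poly_hom cring_hom_of_int)

lemma cring_hom_eval_at: "cring_hom (eval_at w \<zeta>)"
  unfolding eval_at_def
  by (intro cring_hom_comp[OF cring_hom_poly] cring_hom.map_poly_hom cring_hom_poly_of_int)

lemma eval_at_pCons: "eval_at w \<zeta> (pCons c f) = poly (map_poly of_int c) \<zeta> + w * eval_at w \<zeta> f"
  by (simp add: eval_at_def map_poly_pCons)

lemma poly_of_int_pcompose_monom:
  "poly (map_poly of_int (pcompose c (monom 1 p))) (\<zeta>::complex) = poly (map_poly of_int c) (\<zeta> ^ p)"
proof -
  interpret cring_hom "\<lambda>c. poly (map_poly of_int c) \<zeta>"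
    by (rule cring_hom_poly_of_int)
  show ?thesis
  proof (induction c)
    case (pCons a c)
    then show ?case
      by (simp add: pcompose_pCons hom_add hom_mult map_poly_pCons map_poly_monom poly_monom)
  qed simp
qed

lemma eval_at_subst_powers: "eval_at w \<zeta> (subst_powers p f) = eval_at (w ^ p) (\<zeta> ^ p) f"
proof -
  interpret cring_hom "eval_at w \<zeta>"
    by (rule cring_hom_eval_at)
  have monom: "eval_at w \<zeta> (monom 1 p) = w ^ p"
    by (simp add: eval_at_def map_poly_monom poly_monom)
  show ?thesis
    unfolding subst_powers_def
  proof (induction f)
    case 0
    then show ?case by (simp add: hom_0 eval_at_def)
  next
    case (pCons c f)
    then show ?case
      by (simp add: map_poly_pCons pcompose_pCons hom_add hom_mult monom eval_at_pCons
          poly_of_int_pcompose_monom hom_0)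
  qed
qed

text \<open>The divisor is monic, so pseudo-division is ordinary division over the integers. The
  remainder has degree below \<open>M - 1\<close> but vanishes at the \<open>M - 1\<close>
  nontrivial \<open>M\<close>-th roots of unity, hence is zero.\<close>

lemma geometric_sum_dvd:
  assumes M: "0 < M" and roots: "\<And>\<zeta>. \<zeta> ^ M = 1 \<Longrightarrow> \<zeta> \<noteq> (1::complex) \<Longrightarrow> poly (map_poly of_int c) \<zeta> = 0"
  shows "(\<Sum>i<M. monom 1 i) dvd (c :: int poly)"
proof -
  define G where "G = (\<Sum>i<M. monom 1 i :: int poly)"
  interpret cring_hom "map_poly of_int :: int poly \<Rightarrow> complex poly"
    by (intro cring_hom.map_poly_hom cring_hom_of_int)
  have coeff_G: "coeff G i = of_bool (i < M)" for i
    by (simp add: G_def coeff_sum coeff_monom of_bool_def)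
  have deg_G: "degree G = M - 1"
    using M by (intro antisym degree_le le_degree) (auto simp: coeff_G)
  have lead_G: "lead_coeff G = 1"
    using M by (simp add: deg_G coeff_G)
  then have "G \<noteq> 0"
    by auto
  obtain h r where hr: "pseudo_divmod c G = (h, r)"
    by (cases "pseudo_divmod c G")
  have c: "c = G * h + r" and r: "r = 0 \<or> degree r < M - 1"
    using pseudo_divmod[OF \<open>G \<noteq> 0\<close> hr] unfolding lead_G by (simp_all add: deg_G)
  define r' where "r' = map_poly (of_int :: int \<Rightarrow> complex) r"
  have "r' = 0"
  proof (rule ccontr)
    assume "r' \<noteq> 0"
    have "poly r' \<zeta> = 0" if \<zeta>: "\<zeta> ^ M = 1" "\<zeta> \<noteq> 1" for \<zeta>
    proof -
      have "poly (map_poly of_int G) \<zeta> = (\<Sum>i<M. \<zeta> ^ i)"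
        by (simp add: G_def hom_sum poly_sum map_poly_monom poly_monom)
      also have "\<dots> = 0"
        using \<zeta> by (simp add: geometric_sum)
      finally show ?thesis
        using roots[OF \<zeta>] by (simp add: c hom_add hom_mult r'_def)
    qed
    then have "card ({\<zeta>::complex. \<zeta> ^ M = 1} - {1}) \<le> card {\<zeta>. poly r' \<zeta> = 0}"
      using poly_roots_finite[OF \<open>r' \<noteq> 0\<close>] by (intro card_mono) auto
    also have "\<dots> \<le> degree r'"
      by (rule card_poly_roots_bound) fact
    also have "\<dots> = degree r"
      unfolding r'_def by (rule degree_map_poly) simp
    also have "card ({\<zeta>::complex. \<zeta> ^ M = 1} - {1}) = M - 1"
      using card_roots_unity_eq[OF M] by (simp add: card_Diff_singleton)
    finally have "r = 0"
      using r by simp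
    with \<open>r' \<noteq> 0\<close> show False
      by (simp add: r'_def)
  qed
  then have "r = 0"
    by (intro poly_eqI) (simp add: r'_def poly_eq_iff coeff_map_poly)
  with c show ?thesis
    by (simp flip: G_def)
qed

text \<open>For fixed \<zeta>, vanishing at all \<open>w\<close> kills every coefficient in
  \<open>z\<close>; and divisibility by a polynomial free of \<open>z\<close> is tested on these
  coefficients.\<close>

lemma q_bracket_dvdI:
  assumes M: "0 < M" and roots: "\<And>w \<zeta>. \<zeta> ^ M = 1 \<Longrightarrow> \<zeta> \<noteq> 1 \<Longrightarrow> eval_at w \<zeta> F = 0"
  shows "q_bracket M dvd F"
proof -
  have "q_bracket M = [:\<Sum>i<M. monom 1 i:]"
  proof -
    have "qvar ^ i = [:monom 1 i:]" for i
      by (induction i) (simp_all add: qvar_def monom_Suc)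
    then show ?thesis
      unfolding q_bracket_def by (induction M) simp_all
  qed
  moreover have "(\<Sum>i<M. monom 1 i) dvd coeff F i" for i
  proof (rule geometric_sum_dvd[OF M])
    fix \<zeta> :: complex
    assume "\<zeta> ^ M = 1" "\<zeta> \<noteq> 1"
    then have "map_poly (\<lambda>c. poly (map_poly of_int c) \<zeta>) F = 0"
      using roots unfolding eval_at_def poly_all_0_iff_0[symmetric] by blast
    then show "poly (map_poly of_int (coeff F i)) \<zeta> = 0"
      by (simp add: poly_eq_iff coeff_map_poly)
  qed
  ultimately show ?thesis
    by (simp add: const_poly_dvd_iff)
qed

section \<open>The polynomials \<open>T_s\<close> at roots of unity and the congruence\<close>

lemma Phi_eq_master:
  "Phi r m p k n s = vdm k n xx * master k n (exp_one_minus_om r m p s) (exp_half_one_minus_two_om r m p s)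
     (exp_om r m p s) xx (xc zvar) (xc qvar)"
proof -
  interpret cring_hom "xc :: int poly poly \<Rightarrow> _"
    by (rule cring_hom_xc)
  have "xvar = xx" "xconst = xc"
    by (intro ext, simp add: xvar_def xx_def xconst_def xc_def)+
  then show ?thesis
    by (simp add: Phi_def Delta_def Phi_bar_def vdm_def master_def qpoch_def hom_power prod.distrib)
qed

text \<open>Evaluation acts on the coefficients and leaves the exponents of the \<open>x\<close>
  variables alone, so it commutes with extracting a coefficient.\<close>

lemma eval_at_T_poly:
  "eval_at w \<zeta> (T_poly N r m p k n s) = (- 1) ^ (exp_om r m p s * nat \<bar>N\<bar>) *
    lookup (vdm k n xx * master k n (exp_one_minus_om r m p s) (exp_half_one_minus_two_om r m p s)
     (exp_om r m p s) xx (xc w) (xc \<zeta>)) (row_monom k n (\<lambda>_ j. j * p ^ s - 1))"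
proof -
  interpret E: cring_hom "eval_at w \<zeta>"
    by (rule cring_hom_eval_at)
  have "cring_hom (mono_hom (\<lambda>m. m) (eval_at w \<zeta>) :: xpoly \<Rightarrow> (xmonom \<Rightarrow>\<^sub>0 complex))"
    by (rule cring_hom_mono_hom[OF cring_hom_eval_at]) simp_all
  then interpret H: cring_hom "mono_hom (\<lambda>m. m) (eval_at w \<zeta>) :: xpoly \<Rightarrow> (xmonom \<Rightarrow>\<^sub>0 complex)" .
  have Hx: "mono_hom (\<lambda>m. m) (eval_at w \<zeta>) (xx i j) = (xx i j :: xmonom \<Rightarrow>\<^sub>0 complex)" for i j
    by (simp add: xx_def mono_hom_single E.hom_0 E.hom_1)
  have Hc: "mono_hom (\<lambda>m. m) (eval_at w \<zeta>) (xc c) = (xc (eval_at w \<zeta> c) :: xmonom \<Rightarrow>\<^sub>0 complex)" for c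
    by (simp add: xc_def mono_hom_single E.hom_0)
  have "eval_at w \<zeta> zvar = w" "eval_at w \<zeta> qvar = \<zeta>"
    by (simp_all add: eval_at_def zvar_def qvar_def map_poly_pCons)
  then have "mono_hom (\<lambda>m. m) (eval_at w \<zeta>) (Phi r m p k n s) = vdm k n xx *
      master k n (exp_one_minus_om r m p s) (exp_half_one_minus_two_om r m p s) (exp_om r m p s) xx (xc w) (xc \<zeta>)"
    by (simp only: Phi_eq_master H.hom_mult H.hom_vdm H.hom_master Hx Hc)
  moreover have "target_monom p k n s = row_monom k n (\<lambda>_ j. j * p ^ s - 1)"
    by (simp add: target_monom_def row_monom_def)
  ultimately show ?thesis
    using lookup_mono_hom[OF cring_hom_eval_at, of "\<lambda>m. m" w \<zeta> "Phi r m p k n s" "target_monom p k n s"]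
    by (simp add: T_poly_def E.hom_mult E.hom_power E.hom_uminus E.hom_1)
qed

text \<open>The leading factor is \<open>T\<^sub>0 = 1\<close>, left unevaluated.\<close>

lemma eval_at_T_poly_root_of_unity:
  fixes r m p l k n :: nat
  assumes m: "0 < m" "2 * r \<le> m" and p: "odd p" "p = l * m + 1" and kn: "0 < k" "2 * k \<le> n"
    and \<zeta>: "primitive_root_of_unity (p ^ j) \<zeta>"
  shows "lookup (vdm k n xx) (row_monom k n (\<lambda>_ j. j - 1)) * eval_at w \<zeta> (T_poly N r m p k n (j + a)) =
    eval_at w \<zeta> (T_poly N r m p k n j) * eval_at (w ^ p ^ j) 1 (T_poly N r m p k n a)"
proof -
  note ex = exponents[OF m p]
  have "0 < p ^ a"
    using p by simp
  note main = coeff_master_root_of_unity[OF kn \<zeta> ex(1) ex(2) this, of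
      "exp_one_minus_om r m p a" "exp_half_one_minus_two_om r m p a" "exp_om r m p a" w]
  have "((- 1) ^ (p ^ j) :: complex) = - 1"
    using p by (simp add: uminus_power_if)
  then have sign: "(- 1 :: complex) ^ (exp_om r m p (j + a) * nat \<bar>N\<bar>) =
      (- 1) ^ (exp_om r m p j * nat \<bar>N\<bar>) * (- 1) ^ (exp_om r m p a * nat \<bar>N\<bar>)"
    unfolding ex(5) by (simp add: add_mult_distrib power_add mult.assoc power_mult)
  have "\<gamma> * (a * b * X) = (a * Y) * (b * Z)" if "\<gamma> * X = Y * Z" for \<gamma> a b X Y Z :: complex
  proof -
    have "\<gamma> * (a * b * X) = a * b * (\<gamma> * X)"
      by (simp only: mult_ac)
    also have "\<dots> = (a * Y) * (b * Z)"
      unfolding that by (simp only: mult_ac)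
    finally show ?thesis .
  qed
  from this[OF main] show ?thesis
    unfolding eval_at_T_poly sign unfolding ex(3,4,5) power_add .
qed

theorem theorem1p1:
  fixes r m l p k n s :: nat and N :: int
  assumes "0 < r" and "0 < m" and "2 * r \<le> m"
    and "prime p" and "odd p" and "0 < l" and "p = l * m + 1"
    and "0 < k" and "2 * k \<le> n"
    and "1 \<le> s"
  shows "q_bracket (p ^ s) dvd
      T_poly N r m p k n (s + 1) * subst_powers p (T_poly N r m p k n (s - 1))
    - T_poly N r m p k n s * subst_powers p (T_poly N r m p k n s)"
proof (rule q_bracket_dvdI)
  show "0 < p ^ s"
    using \<open>prime p\<close> by (simp add: prime_gt_0_nat)
  fix w \<zeta> :: complex
  assume \<zeta>: "\<zeta> ^ p ^ s = 1" "\<zeta> \<noteq> 1"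
  interpret cring_hom "eval_at w \<zeta>"
    by (rule cring_hom_eval_at)
  define T where "T = (\<lambda>a w \<zeta>. eval_at w \<zeta> (T_poly N r m p k n a))"
  define \<gamma> where "\<gamma> = lookup (vdm k n xx :: xmonom \<Rightarrow>\<^sub>0 complex) (row_monom k n (\<lambda>_ j. j - 1))"
  \<comment> \<open>The order of \<zeta>. It divides \<open>p ^ s\<close> and exceeds 1, so it is
    \<open>p ^ j\<close> with \<open>1 \<le> j \<le> s\<close>.\<close>
  define M where "M = (LEAST t. 0 < t \<and> \<zeta> ^ t = 1)"
  have M: "0 < M \<and> \<zeta> ^ M = 1"
    unfolding M_def by (rule LeastI[of _ "p ^ s"]) (use \<open>0 < p ^ s\<close> \<zeta> in simp)
  have M_least: "\<zeta> ^ t \<noteq> 1" if "0 < t" "t < M" for t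
    using not_less_Least[of t "\<lambda>t. 0 < t \<and> \<zeta> ^ t = 1"] that unfolding M_def by blast
  have "\<zeta> ^ (p ^ s mod M) = \<zeta> ^ (M * (p ^ s div M) + p ^ s mod M)"
    unfolding power_add power_mult using M by simp
  also have "\<dots> = 1"
    using \<zeta> by simp
  finally have "M dvd p ^ s"
    using M_least[of "p ^ s mod M"] M by (metis bot_nat_0.not_eq_extremum dvd_eq_mod_eq_0 mod_less_divisor)
  then obtain j where j: "j \<le> s" "M = p ^ j"
    using divides_primepow_nat[OF \<open>prime p\<close>] by blast
  have "j \<noteq> 0"
    using M \<zeta> j by (intro notI) simp
  then obtain i where i: "j = Suc i"
    by (cases j) auto
  obtain a where a: "s = j + a"
    using j le_Suc_ex by blast
  have prim: "primitive_root_of_unity (p ^ j) \<zeta>"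
    using M M_least unfolding primitive_root_of_unity_def j(2)[symmetric] by blast
  \<comment> \<open>\<open>\<zeta> ^ p\<close> has order \<open>p ^ (j - 1)\<close>; for
    \<open>j = 1\<close> it is 1, a primitive root of order one.\<close>
  have "(\<zeta> ^ p) ^ t \<noteq> 1" if "0 < t" "t < p ^ i" for t
    using M_least[of "p * t"] that \<open>prime p\<close> by (simp add: j i prime_gt_0_nat flip: power_mult)
  then have prim': "primitive_root_of_unity (p ^ i) (\<zeta> ^ p)"
    using M by (simp add: primitive_root_of_unity_def j i prime_gt_0_nat[OF \<open>prime p\<close>] flip: power_mult)
  have fact: "\<gamma> * T (j + a) w \<zeta> = T j w \<zeta> * T a (w ^ p ^ j) 1"
    if "primitive_root_of_unity (p ^ j) \<zeta>" for j a w \<zeta>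
    unfolding T_def \<gamma>_def by (rule eval_at_T_poly_root_of_unity[OF assms(2,3,5,7,8,9) that])
  have "T (s + 1) w \<zeta> * T (s - 1) (w ^ p) (\<zeta> ^ p) = T s w \<zeta> * T s (w ^ p) (\<zeta> ^ p)"
  proof (cases "\<gamma> = 0")
    case True
    \<comment> \<open>This case replaces the computation of \<open>\<gamma>\<close>: if
      \<open>\<gamma>\<close> were zero, the Vandermonde product and with it every value of
      \<open>T\<close> would vanish.\<close>
    have "(vdm k n xx :: xmonom \<Rightarrow>\<^sub>0 complex) = 0"
    proof (rule alternating_staircase_zero)
      show "lookup (vdm k n xx :: xmonom \<Rightarrow>\<^sub>0 complex) (row_monom k n (\<lambda>_ j. j - 1)) = 0"
        using True by (simp add: \<gamma>_def)
    qed (fact alternating_vdm[OF assms(8,9)], erule deg_le_vdm, erule vdim_pos[OF assms(8,9)])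
    then show ?thesis
      by (simp add: T_def eval_at_T_poly)
  next
    case False
    \<comment> \<open>The factorization for \<zeta> at \<open>w\<close> and that for
      \<open>\<zeta> ^ p\<close> at \<open>w ^ p\<close> lead to the same argument \<open>u\<close>.
      Both products, multiplied by \<open>\<gamma>\<close> twice, thus have the same four factors,
      with indices \<open>j\<close>, \<open>i\<close>, \<open>a\<close> and
      \<open>Suc a\<close>.\<close>
    define u where "u = w ^ p ^ j"
    have u: "(w ^ p) ^ p ^ i = u"
      by (simp add: u_def i flip: power_mult)
    have "\<gamma> * T (s + 1) w \<zeta> = T j w \<zeta> * T (Suc a) u 1" "\<gamma> * T s w \<zeta> = T j w \<zeta> * T a u 1"
      using fact[OF prim, where w = w and a = "Suc a"] fact[OF prim, where w = w and a = a] by (simp_all add: a u_def)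
    moreover have "\<gamma> * T (s - 1) (w ^ p) (\<zeta> ^ p) = T i (w ^ p) (\<zeta> ^ p) * T a u 1"
      "\<gamma> * T s (w ^ p) (\<zeta> ^ p) = T i (w ^ p) (\<zeta> ^ p) * T (Suc a) u 1"
      using fact[OF prim', where w = "w ^ p" and a = a] fact[OF prim', where w = "w ^ p" and a = "Suc a"]
      unfolding u by (simp_all add: a i)
    ultimately have "(\<gamma> * T (s + 1) w \<zeta>) * (\<gamma> * T (s - 1) (w ^ p) (\<zeta> ^ p)) =
        (\<gamma> * T s w \<zeta>) * (\<gamma> * T s (w ^ p) (\<zeta> ^ p))"
      by simp
    with False show ?thesis
      by simp
  qed
  then show "eval_at w \<zeta> (T_poly N r m p k n (s + 1) * subst_powers p (T_poly N r m p k n (s - 1))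
      - T_poly N r m p k n s * subst_powers p (T_poly N r m p k n s)) = 0"
    by (simp add: hom_diff hom_mult eval_at_subst_powers T_def)
qed

end
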